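(* Let $r\in\mathbb{N}$ with $r\ge 2$ and let $p_1,\ldots,p_r\in\mathbb{N}$. Then, for $\tau\in\mathbb{C}$ with $\operatorname{Im}(\tau)>0$, $$\tau^{2(p_1+\cdots+p_r)}\,\widetilde{G}_{2p_1,\ldots,2p_r}(\tau)\in \mathbb{Q}\left[ \tau^2,\, \pi^2,\,G_{2}(\tau),\,G_4(\tau),\,G_6(\tau)\right].$$
   Context: $\mathbb{N}=\{1,2,3,\dots\}$. For $\tau\in\mathbb{C}$ with $\operatorname{Im}(\tau)>0$ and $j\in\mathbb{N}$, the Eisenstein series is $$G_{2j}(\tau)=\sum_{m\in\mathbb{Z}}\ \sum_{\substack{n\in\mathbb{Z}\\ (m,n)\neq(0,0)}}\frac{1}{(m+n\tau)^{2j}}.$$ For $j\ge 2$ this converges absolutely. For $j=1$ it is conditionally convergent and is taken in the indicated order: inner sum over $n$, outer sum over $m$, where $n$ is the coefficient of $\tau$. (This differs from the usual $G_2$, in which the inner sum runs over the integer not multiplied by $\tau$.) For $r\ge2$ and $p_1,\dots,p_r\in\mathbb{N}$, $$\widetilde{G}_{2p_1,\ldots,2p_r}(\tau)=\sum_{m\in\mathbb{Z}}\ \sum_{\substack{n_1\in\mathbb{Z}\\ (m,n_1)\neq(0,0)}}\cdots\sum_{\substack{n_r\in\mathbb{Z}\\ (m,n_r)\neq(0,0)}}\ \prod_{j=1}^{r}\frac{1}{(m+n_j\tau)^{2p_j}},$$ with the summation taken in the indicated order (outer sum over $m$). $\mathbb{Q}[\tau^2,\pi^2,G_2(\tau),G_4(\tau),G_6(\tau)]$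 denotes the set of polynomial expressions with rational coefficients in the listed quantities, viewed as functions of $\tau$. *)

theory Defs
  imports "HOL-Analysis.Analysis"
begin

text \<open>
  All series below are iterated sums, taken in the nesting order of the \<open>infsum\<close>s. For
  \<open>Im \<tau> > 0\<close> and even exponents at least 2, each single sum converges absolutely:
  the inner ones by comparison with \<open>1 / n\<^sup>2\<close>, the outer one because the inner sums
  decay exponentially in \<open>\<bar>m\<bar>\<close>. So \<open>infsum\<close> never takes its default value
  there; only the order of summation matters in weight 2.
\<close>

text \<open>
  The outer variable \<open>m\<close> is the one \<^emph>\<open>not\<close> multiplied by \<open>\<tau>\<close>, so
  \<open>eisenstein_G 2\<close> is not the usual \<open>G\<^sub>2\<close>.
\<close>

definition eisenstein_G :: "nat \<Rightarrow> complex \<Rightarrow> complex" where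
  "eisenstein_G k \<tau> =
     (\<Sum>\<^sub>\<infinity>m::int. \<Sum>\<^sub>\<infinity>n\<in>{n::int. (m, n) \<noteq> (0, 0)}.
        1 / (of_int m + of_int n * \<tau>) ^ k)"

text \<open>
  \<open>iterated_infsum A r f\<close> is the \<open>r\<close>-fold sum of \<open>f [n\<^sub>1, \<dots>, n\<^sub>r]\<close> over
  \<open>n\<^sub>1 \<in> A\<close> (outermost), \<dots>, \<open>n\<^sub>r \<in> A\<close> (innermost).
\<close>

primrec iterated_infsum :: "int set \<Rightarrow> nat \<Rightarrow> (int list \<Rightarrow> complex) \<Rightarrow> complex" where
  "iterated_infsum A 0 f = f []"
| "iterated_infsum A (Suc r) f = (\<Sum>\<^sub>\<infinity>n\<in>A. iterated_infsum A r (\<lambda>ns. f (n # ns)))"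

text \<open>The list \<open>ps\<close> is \<open>[p\<^sub>1, \<dots>, p\<^sub>r]\<close>; the exponents are the doubled entries.\<close>

definition G_tilde :: "nat list \<Rightarrow> complex \<Rightarrow> complex" where
  "G_tilde ps \<tau> =
     (\<Sum>\<^sub>\<infinity>m::int. iterated_infsum {n::int. (m, n) \<noteq> (0, 0)} (length ps)
        (\<lambda>ns. \<Prod>j<length ps. 1 / (of_int m + of_int (ns ! j) * \<tau>) ^ (2 * ps ! j)))"

text \<open>
  The functions which on \<open>D\<close> are a polynomial expression with rational coefficients in the
  functions \<open>gs\<close>. The finite set \<open>S\<close> of exponent vectors and the coefficients
  \<open>c\<close> do not depend on the point \<open>z\<close>.
\<close>

definition rat_polynomials_on ::
    "complex set \<Rightarrow> (complex \<Rightarrow> complex) list \<Rightarrow> (complex \<Rightarrow> complex) set" where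
  "rat_polynomials_on D gs =
     {f. \<exists>(S :: nat list set) (c :: nat list \<Rightarrow> rat).
           finite S \<and> (\<forall>e\<in>S. length e = length gs) \<and>
           (\<forall>z\<in>D. f z = (\<Sum>e\<in>S. of_rat (c e) * (\<Prod>i<length gs. (gs ! i) z ^ (e ! i))))}"

end

theory Submission
  imports Defs "HOL-Computational_Algebra.Polynomial"
begin

text \<open>
  For \<open>m \<noteq> 0\<close> the inner sum of weight \<open>2 p\<close>, multiplied by \<open>\<tau> ^ (2 p)\<close>, is
  \<open>e\<^sub>p(m / \<tau>)\<close> with \<open>e\<^sub>p(z) = (\<Sum>n. 1 / (z + n) ^ (2 p))\<close>. Differentiating
  \<open>e\<^sub>1(z) = X(z) = (\<pi> / sin (\<pi> z))\<^sup>2\<close> twice and repeatedly shows that over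
  \<open>\<rat>[\<pi>\<^sup>2]\<close> the functions \<open>e\<^sub>1, e\<^sub>2, \<dots>\<close> and \<open>X, X\<^sup>2, \<dots>\<close> span
  the same module. That module is closed under products, so \<open>\<Prod>j. e\<^bsub>p\<^sub>j\<^esub>\<close> is a
  combination of single \<open>e\<^sub>k\<close>, and summing over \<open>m\<close> yields the \<open>\<tau> ^ (2 k) G\<^sub>2\<^sub>k(\<tau>)\<close>; the
  terms with \<open>m = 0\<close> are even zeta values, which lie in \<open>\<rat>[\<pi>\<^sup>2]\<close> because
  \<open>X(1/2) = \<pi>\<^sup>2\<close>.

  That \<open>G\<^sub>2\<^sub>k\<close> for \<open>k \<ge> 4\<close> is a rational polynomial in \<open>G\<^sub>4\<close> and \<open>G\<^sub>6\<close> is shown without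
  elliptic functions: one combination of the partial fraction expansions of
  \<open>1 / (u ^ a v ^ b)\<close> in \<open>u\<close>, \<open>v\<close>, \<open>u + v\<close> has no terms with an exponent below 3, so it can be
  summed absolutely over pairs of lattice points.
\<close>

section \<open>The ring of rational polynomial expressions\<close>

text \<open>Agreement is asked on \<open>D\<close> only, so identities valid just for
  \<open>Im \<tau> > 0\<close> may change the representing function.\<close>

lemma rat_polynomials_on_cong:
  assumes "f \<in> rat_polynomials_on D gs" and "\<And>z. z \<in> D \<Longrightarrow> f z = g z"
  shows "g \<in> rat_polynomials_on D gs"
  using assms unfolding rat_polynomials_on_def by auto

lemma rat_polynomials_on_monomial:
  assumes "length e = length gs"
  shows "(\<lambda>z. of_rat q * (\<Prod>i<length gs. (gs ! i) z ^ (e ! i))) \<in> rat_polynomials_on D gs"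
  unfolding rat_polynomials_on_def using assms
  by (auto intro!: exI[of _ "{e}"] exI[of _ "\<lambda>_. q"])

lemma rat_polynomials_on_const: "(\<lambda>_. of_rat q) \<in> rat_polynomials_on D gs"
  using rat_polynomials_on_monomial[of "replicate (length gs) 0" gs q D]
  by (rule rat_polynomials_on_cong) auto

lemma rat_polynomials_on_generator:
  assumes "g \<in> set gs"
  shows "g \<in> rat_polynomials_on D gs"
proof -
  obtain k where k: "k < length gs" "gs ! k = g"
    using assms by (auto simp: in_set_conv_nth)
  define e where "e = (replicate (length gs) (0::nat))[k := 1]"
  have "(\<Prod>i<length gs. (gs ! i) z ^ (e ! i)) = g z" for z
  proof -
    have "(\<Prod>i<length gs. (gs ! i) z ^ (e ! i)) = (\<Prod>i<length gs. if i = k then g z else 1)"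
      using k by (intro prod.cong) (auto simp: e_def nth_list_update)
    also have "\<dots> = g z"
      using k by simp
    finally show ?thesis .
  qed
  moreover have "(\<lambda>z. of_rat 1 * (\<Prod>i<length gs. (gs ! i) z ^ (e ! i))) \<in> rat_polynomials_on D gs"
    by (rule rat_polynomials_on_monomial) (simp add: e_def)
  ultimately show ?thesis by simp
qed

lemma rat_polynomials_on_add:
  assumes "f \<in> rat_polynomials_on D gs" and "g \<in> rat_polynomials_on D gs"
  shows "(\<lambda>z. f z + g z) \<in> rat_polynomials_on D gs"
proof -
  obtain S c where S: "finite S" "\<forall>e\<in>S. length e = length gs"
    and f: "\<And>z. z \<in> D \<Longrightarrow> f z = (\<Sum>e\<in>S. of_rat (c e) * (\<Prod>i<length gs. (gs ! i) z ^ (e ! i)))"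
    using assms(1) unfolding rat_polynomials_on_def by auto
  obtain T d where T: "finite T" "\<forall>e\<in>T. length e = length gs"
    and g: "\<And>z. z \<in> D \<Longrightarrow> g z = (\<Sum>e\<in>T. of_rat (d e) * (\<Prod>i<length gs. (gs ! i) z ^ (e ! i)))"
    using assms(2) unfolding rat_polynomials_on_def by auto
  \<comment> \<open>Exponent vectors common to \<open>S\<close> and \<open>T\<close> receive both
    coefficients; elsewhere the missing one is padded by 0.\<close>
  define h where "h e = (if e \<in> S then c e else 0) + (if e \<in> T then d e else 0)" for e
  have "f z + g z = (\<Sum>e\<in>S \<union> T. of_rat (h e) * (\<Prod>i<length gs. (gs ! i) z ^ (e ! i)))"
    if "z \<in> D" for z
  proof -
    have "f z = (\<Sum>e\<in>S \<union> T. of_rat (if e \<in> S then c e else 0)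
        * (\<Prod>i<length gs. (gs ! i) z ^ (e ! i)))"
      unfolding f[OF that] by (rule sum.mono_neutral_cong_left) (use S T in auto)
    moreover have "g z = (\<Sum>e\<in>S \<union> T. of_rat (if e \<in> T then d e else 0)
        * (\<Prod>i<length gs. (gs ! i) z ^ (e ! i)))"
      unfolding g[OF that] by (rule sum.mono_neutral_cong_left) (use S T in auto)
    ultimately show ?thesis
      by (simp add: h_def of_rat_add algebra_simps sum.distrib)
  qed
  with S T show ?thesis
    unfolding rat_polynomials_on_def by (auto intro!: exI[of _ "S \<union> T"] exI[of _ h])
qed

lemma rat_polynomials_on_sum:
  assumes "\<And>i. i \<in> I \<Longrightarrow> f i \<in> rat_polynomials_on D gs"
  shows "(\<lambda>z. \<Sum>i\<in>I. f i z) \<in> rat_polynomials_on D gs"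
  using assms
proof (induction I rule: infinite_finite_induct)
  case (insert i I)
  then show ?case using rat_polynomials_on_add[of "f i" D gs "\<lambda>z. \<Sum>i\<in>I. f i z"] by simp
qed (use rat_polynomials_on_const[of 0] in simp_all)

text \<open>Monomials multiply by adding exponent vectors. Different pairs may give the same vector,
  so the double sum stays indexed by pairs and closure under sums merges the collisions.\<close>

lemma rat_polynomials_on_mult:
  assumes "f \<in> rat_polynomials_on D gs" and "g \<in> rat_polynomials_on D gs"
  shows "(\<lambda>z. f z * g z) \<in> rat_polynomials_on D gs"
proof -
  obtain S c where S: "finite S" "\<forall>e\<in>S. length e = length gs"
    and f: "\<And>z. z \<in> D \<Longrightarrow> f z = (\<Sum>e\<in>S. of_rat (c e) * (\<Prod>i<length gs. (gs ! i) z ^ (e ! i)))"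
    using assms(1) unfolding rat_polynomials_on_def by auto
  obtain T d where T: "finite T" "\<forall>e\<in>T. length e = length gs"
    and g: "\<And>z. z \<in> D \<Longrightarrow> g z = (\<Sum>e\<in>T. of_rat (d e) * (\<Prod>i<length gs. (gs ! i) z ^ (e ! i)))"
    using assms(2) unfolding rat_polynomials_on_def by auto
  have "(\<lambda>z. \<Sum>p\<in>S \<times> T. of_rat (c (fst p) * d (snd p)) *
          (\<Prod>i<length gs. (gs ! i) z ^ (map2 (+) (fst p) (snd p) ! i))) \<in> rat_polynomials_on D gs"
    using S T by (intro rat_polynomials_on_sum rat_polynomials_on_monomial) auto
  then show ?thesis
  proof (rule rat_polynomials_on_cong)
    fix z assume z: "z \<in> D"
    have "f z * g z = (\<Sum>(e, e')\<in>S \<times> T.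
        (of_rat (c e) * (\<Prod>i<length gs. (gs ! i) z ^ (e ! i))) *
        (of_rat (d e') * (\<Prod>i<length gs. (gs ! i) z ^ (e' ! i))))"
      by (simp add: f[OF z] g[OF z] sum_product sum.cartesian_product)
    also have "\<dots> = (\<Sum>p\<in>S \<times> T. of_rat (c (fst p) * d (snd p)) *
          (\<Prod>i<length gs. (gs ! i) z ^ (map2 (+) (fst p) (snd p) ! i)))"
    proof (rule sum.cong)
      fix p assume "p \<in> S \<times> T"
      then have "length (fst p) = length gs" "length (snd p) = length gs"
        using S T by auto
      then show "(case p of (e, e') \<Rightarrow>
            (of_rat (c e) * (\<Prod>i<length gs. (gs ! i) z ^ (e ! i))) *
            (of_rat (d e') * (\<Prod>i<length gs. (gs ! i) z ^ (e' ! i)))) =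
          of_rat (c (fst p) * d (snd p)) *
          (\<Prod>i<length gs. (gs ! i) z ^ (map2 (+) (fst p) (snd p) ! i))"
        by (simp add: case_prod_beta of_rat_mult power_add prod.distrib)
    qed simp
    finally show "(\<Sum>p\<in>S \<times> T. of_rat (c (fst p) * d (snd p)) *
          (\<Prod>i<length gs. (gs ! i) z ^ (map2 (+) (fst p) (snd p) ! i))) = f z * g z"
      by simp
  qed
qed

lemma rat_polynomials_on_power:
  assumes "f \<in> rat_polynomials_on D gs"
  shows "(\<lambda>z. f z ^ k) \<in> rat_polynomials_on D gs"
proof (induction k)
  case 0
  show ?case using rat_polynomials_on_const[of 1] by simp
next
  case (Suc k)
  show ?case using rat_polynomials_on_mult[OF assms Suc] by simp
qed

lemma rat_polynomials_on_diff:
  assumes "f \<in> rat_polynomials_on D gs" and "g \<in> rat_polynomials_on D gs"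
  shows "(\<lambda>z. f z - g z) \<in> rat_polynomials_on D gs"
proof -
  have "(\<lambda>z. f z + of_rat (- 1) * g z) \<in> rat_polynomials_on D gs"
    by (intro rat_polynomials_on_add rat_polynomials_on_mult rat_polynomials_on_const assms)
  then show ?thesis
    by (rule rat_polynomials_on_cong) simp
qed

section \<open>Partial fractions of inverse powers\<close>

text \<open>With \<open>U = 1 / u\<close>, \<open>V = 1 / v\<close>, \<open>W = 1 / (u + v)\<close>
  this is the partial fraction expansion of \<open>1 / (u ^ Suc a * v ^ Suc b)\<close>. Both halves
  share one range; the binomial coefficients vanish for \<open>i > a\<close> in the first and for
  \<open>i > b\<close> in the second.\<close>

definition pf_sum :: "complex \<Rightarrow> complex \<Rightarrow> complex \<Rightarrow> nat \<Rightarrow> nat \<Rightarrow> complex" where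
  "pf_sum U V W a b =
    (\<Sum>i\<le>a + b. (of_nat ((a + b - i) choose b) * U ^ Suc i
                + of_nat ((a + b - i) choose a) * V ^ Suc i) * W ^ Suc (a + b - i))"

lemma pf_sum_commute: "pf_sum U V W a b = pf_sum V U W b a"
  by (simp add: pf_sum_def add.commute)

lemma pf_sum_0: "pf_sum U V W 0 b = U * W ^ Suc b + (\<Sum>i\<le>b. V ^ Suc i * W ^ Suc (b - i))"
proof -
  have "pf_sum U V W 0 b = (\<Sum>i\<le>b. (if i = 0 then U * W ^ Suc b else 0) + V ^ Suc i
      * W ^ Suc (b - i))"
    unfolding pf_sum_def by (intro sum.cong) (auto simp: binomial_eq_0 algebra_simps)
  then show ?thesis by (simp add: sum.distrib)
qed

text \<open>Pascal's rule in both halves. The top term on the left vanishes because its binomial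
  coefficients are \<open>0 choose Suc _\<close>.\<close>

lemma pf_sum_step: "pf_sum U V W (Suc a) (Suc b)
    = W * (pf_sum U V W a (Suc b) + pf_sum U V W (Suc a) b)"
proof -
  have top: "(\<Sum>i\<le>Suc (Suc (a + b)). f i) = (\<Sum>i\<le>Suc (a + b). f i) + f (Suc (Suc (a + b)))"
    for f :: "nat \<Rightarrow> complex" by simp
  have "pf_sum U V W (Suc a) (Suc b) =
    (\<Sum>i\<le>Suc (a + b). (of_nat (Suc (Suc (a + b) - i) choose Suc b) * U ^ Suc i
       + of_nat (Suc (Suc (a + b) - i) choose Suc a) * V ^ Suc i)
           * W ^ Suc (Suc (Suc (a + b) - i)))"
    unfolding pf_sum_def add_Suc add_Suc_right top
    by (simp add: Suc_diff_le del: sum.atMost_Suc binomial_Suc_Suc power_Suc)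
  also have "\<dots> = W * (pf_sum U V W a (Suc b) + pf_sum U V W (Suc a) b)"
    unfolding pf_sum_def
    by (simp add: sum_distrib_left sum.distrib[symmetric] algebra_simps del: sum.atMost_Suc)
  finally show ?thesis .
qed

text \<open>The hypothesis is the case \<open>a = b = 0\<close>. Replacing one factor
  \<open>U * V\<close> by \<open>W * (U + V)\<close> lowers one of the two exponents, and by
  \<open>pf_sum_step\<close> the right side obeys the same recursion.\<close>

lemma partial_fractions_inverse_powers:
  assumes UV: "U * V = W * (U + V)"
  shows "U ^ Suc a * V ^ Suc b = pf_sum U V W a b"
proof -
  \<comment> \<open>Generalised over \<open>U\<close> and \<open>V\<close>, since the boundary case
    \<open>b = 0\<close> below uses it with the two exchanged.\<close>
  have base: "U * V ^ Suc b = pf_sum U V W 0 b" if UV: "U * V = W * (U + V)" for U V b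
  proof (induction b)
    case 0
    show ?case using UV by (simp add: pf_sum_def algebra_simps)
  next
    case (Suc b)
    have "U * V ^ Suc (Suc b) = (U * V) * V ^ Suc b"
      by (simp add: algebra_simps)
    also have "\<dots> = W * (V ^ Suc (Suc b) + U * V ^ Suc b)"
      by (simp add: UV algebra_simps)
    also have "\<dots> = W * (V ^ Suc (Suc b) + U * W ^ Suc b + (\<Sum>i\<le>b. V ^ Suc i * W ^ Suc (b - i)))"
      by (simp only: Suc pf_sum_0 add.assoc)
    also have "\<dots> = pf_sum U V W 0 (Suc b)"
      by (simp add: pf_sum_0 sum_distrib_left Suc_diff_le algebra_simps)
    finally show ?case .
  qed
  show ?thesis
  proof (induction a arbitrary: b)
    case 0
    show ?case using base[OF UV] by simp
  next
    case (Suc a)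
    show ?case
    proof (induction b)
      case 0
      show ?case
        using base[of V U "Suc a"] UV by (simp add: pf_sum_commute[of U] algebra_simps)
    next
      case (Suc b)
      have "U ^ Suc (Suc a) * V ^ Suc (Suc b) = (U * V) * (U ^ Suc a * V ^ Suc b)"
        by (simp add: algebra_simps)
      also have "\<dots> = W * (U ^ Suc a * V ^ Suc (Suc b) + U ^ Suc (Suc a) * V ^ Suc b)"
        by (simp add: UV algebra_simps)
      finally show ?case
        by (simp only: pf_sum_step Suc \<open>\<And>b. U ^ Suc a * V ^ Suc b = pf_sum U V W a b\<close>)
    qed
  qed
qed

text \<open>
  The weights \<open>3\<close> and \<open>M - 2\<close> are chosen so that the terms with exponents 1 and 2,
  over which the lattice sums would not converge absolutely, cancel.
\<close>

definition rec_coeff :: "nat \<Rightarrow> nat \<Rightarrow> int" where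
  "rec_coeff M i = 3 * (int ((M - i) choose (M - 3)) + int ((M - i) choose 3))
     - int (M - 2) * (int ((M - i) choose (M - 2)) + int ((M - i) choose 2))"

lemma Suc_times_choose_Suc: "Suc k * (n choose Suc k) = (n - k) * (n choose k)"
  by (simp only: binomial_absorption binomial_absorb_comp)

lemma has_sum_finite_sum:
  fixes f :: "'i \<Rightarrow> 'a \<Rightarrow> 'b :: topological_comm_monoid_add"
  assumes "\<And>i. i \<in> I \<Longrightarrow> (f i has_sum S i) A"
  shows "((\<lambda>x. \<Sum>i\<in>I. f i x) has_sum (\<Sum>i\<in>I. S i)) A"
  using assms by (induction I rule: infinite_finite_induct) (auto intro: has_sum_add)

lemma choose_complement: "k + j = n \<Longrightarrow> n choose k = n choose j"
  using binomial_symmetric[of k n] by auto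

text \<open>Index \<open>i\<close> belongs to the exponents \<open>Suc i\<close> and
  \<open>M + 1 - i\<close>, so these are the indices with an exponent below 3. At 0 and, after
  Pascal's rule, at 1 the cancellation is \<open>3 * (M choose 3) = (M - 2) * (M choose 2)\<close>;
  at \<open>M - 1\<close> and \<open>M\<close> every binomial coefficient is 0.\<close>

lemma rec_coeff_boundary:
  assumes "M \<ge> 6" and "i = 0 \<or> i = 1 \<or> i = M - 1 \<or> i = M"
  shows "rec_coeff M i = 0"
proof -
  have three: "3 * int (M choose 3) = int (M - 2) * int (M choose 2)"
    using Suc_times_choose_Suc[of 2 M] by (simp add: eval_nat_numeral flip: of_nat_mult)
  have pascal: "M choose 3 = (M - 1 choose 2) + (M - 1 choose 3)"
      "M choose 2 = (M - 1 choose 1) + (M - 1 choose 2)"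
    using assms binomial_Suc_Suc[of "M - 1" 2] binomial_Suc_Suc[of "M - 1" 1]
    by (simp_all add: eval_nat_numeral)
  have "M choose (M - 3) = M choose 3" "M choose (M - 2) = M choose 2"
    "M - 1 choose (M - 3) = M - 1 choose 2" "M - 1 choose (M - 2) = M - 1 choose 1"
    using assms by (auto intro: choose_complement simp del: One_nat_def binomial_1)
  then show ?thesis
    using assms(2)
  proof (elim disjE)
    assume "i = 1"
    then show ?thesis
      using three pascal \<open>M - 1 choose (M - 3) = _\<close> \<open>M - 1 choose (M - 2) = _\<close>
      by (simp add: rec_coeff_def)
  next
    assume "i = M - 1"
    moreover have "Suc 0 choose (M - 3) = 0" "Suc 0 choose (M - 2) = 0"
      using assms(1) by (auto intro!: binomial_eq_0)
    ultimately show ?thesis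
      using assms(1) by (simp add: rec_coeff_def binomial_eq_0)
  qed (use assms three in \<open>auto simp: rec_coeff_def binomial_eq_0\<close>)
qed

lemma sum_rec_coeff:
  fixes f :: "nat \<Rightarrow> 'a :: comm_ring_1"
  assumes "M \<ge> 6"
  shows "(\<Sum>i\<le>M. of_int (rec_coeff M i) * f i) = (\<Sum>i=2..M - 2. of_int (rec_coeff M i) * f i)"
proof (rule sum.mono_neutral_right)
  show "\<forall>i\<in>{..M} - {2..M - 2}. of_int (rec_coeff M i) * f i = 0"
  proof
    fix i assume "i \<in> {..M} - {2..M - 2}"
    then have "i = 0 \<or> i = 1 \<or> i = M - 1 \<or> i = M"
      using assms by auto
    then show "of_int (rec_coeff M i) * f i = 0"
      by (simp only: rec_coeff_boundary[OF assms] of_int_0 mult_zero_left)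
  qed
qed (use assms in auto)

text \<open>This keeps the factor of \<open>G (M + 2)\<close> in \<open>G_recursion\<close> nonzero.
  Hockey-stick summation evaluates the sum; 4 times it is
  \<open>(5 - M) * (Suc (Suc M) choose 3)\<close>.\<close>

lemma sum_rec_coeff_nonpos:
  assumes "M \<ge> 6"
  shows "(\<Sum>i=2..M - 2. rec_coeff M i) \<le> 0"
proof -
  have rev: "(\<Sum>i\<le>M. int ((M - i) choose k)) = int (Suc M choose Suc k)" for k
  proof -
    have "(\<Sum>i\<le>M. int ((M - i) choose k)) = (\<Sum>i\<le>M. int (i choose k))"
      by (rule sum.reindex_bij_witness[of _ "\<lambda>i. M - i" "\<lambda>i. M - i"]) auto
    then show ?thesis
      by (simp only: sum_choose_upper flip: of_nat_sum)
  qed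
  have "(\<Sum>i\<le>M. rec_coeff M i) =
      3 * (int (Suc M choose Suc (M - 3)) + int (Suc M choose Suc 3))
      - int (M - 2) * (int (Suc M choose Suc (M - 2)) + int (Suc M choose Suc 2))"
    unfolding rec_coeff_def sum_subtractf sum.distrib sum_distrib_left[symmetric] rev ..
  also have "Suc M choose Suc (M - 3) = Suc M choose 3"
    by (rule choose_complement) (use assms in simp)
  also have "Suc M choose Suc (M - 2) = Suc M choose 2"
    by (rule choose_complement) (use assms in simp)
  also have "3 * (int (Suc M choose 3) + int (Suc M choose Suc 3))
      - int (M - 2) * (int (Suc M choose 2) + int (Suc M choose Suc 2))
      = 3 * int (Suc (Suc M) choose 4) - int (M - 2) * int (Suc (Suc M) choose 3)"
    using binomial_Suc_Suc[of "Suc M" 3] binomial_Suc_Suc[of "Suc M" 2]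
    by (simp add: eval_nat_numeral)
  finally have S: "(\<Sum>i\<le>M. rec_coeff M i) =
      3 * int (Suc (Suc M) choose 4) - int (M - 2) * int (Suc (Suc M) choose 3)" .
  have "4 * (n choose 4) = (n - 3) * (n choose 3)" for n :: nat
    using Suc_times_choose_Suc[of 3 n] by simp
  from arg_cong[OF this[of "Suc (Suc M)"], of int]
  have "4 * int (Suc (Suc M) choose 4) = int (M - 1) * int (Suc (Suc M) choose 3)"
    by (simp only: of_nat_mult of_nat_numeral) simp
  then have "4 * (\<Sum>i\<le>M. rec_coeff M i)
      = (3 * int (M - 1) - 4 * int (M - 2)) * int (Suc (Suc M) choose 3)"
    unfolding S by (simp add: algebra_simps)
  also have "\<dots> \<le> 0"
    using assms by (intro mult_nonpos_nonneg) (auto simp: of_nat_diff)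
  finally show ?thesis
    using sum_rec_coeff[OF assms, of "\<lambda>_. 1::int"] by simp
qed

text \<open>The expansions for \<open>(a, b)\<close> equal to \<open>(3, M - 3)\<close> and
  \<open>(2, M - 2)\<close> and their mirror images all have \<open>a + b = M\<close>. Adding mirror
  images makes the coefficients of the \<open>U\<close> and \<open>V\<close> terms equal.\<close>

lemma rec_coeff_partial_fractions:
  fixes U V W :: complex
  assumes "M \<ge> 6" and "U * V = W * (U + V)"
  shows "3 * (U ^ 4 * V ^ (M - 2) + U ^ (M - 2) * V ^ 4)
       - of_nat (M - 2) * (U ^ 3 * V ^ (M - 1) + U ^ (M - 1) * V ^ 3)
     = (\<Sum>i=2..M - 2. of_int (rec_coeff M i)
         * (U ^ Suc i * W ^ (M + 1 - i) + V ^ Suc i * W ^ (M + 1 - i)))"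
proof -
  have e: "4 = Suc 3" "3 = Suc 2" "M - 2 = Suc (M - 3)" "M - 1 = Suc (M - 2)"
    and s: "3 + (M - 3) = M" "M - 3 + 3 = M" "2 + (M - 2) = M" "M - 2 + 2 = M"
    using assms by simp_all
  have p: "U ^ 4 * V ^ (M - 2) = pf_sum U V W 3 (M - 3)"
      "U ^ (M - 2) * V ^ 4 = pf_sum U V W (M - 3) 3"
    "U ^ 3 * V ^ (M - 1) = pf_sum U V W 2 (M - 2)" "U ^ (M - 1) * V ^ 3 = pf_sum U V W (M - 2) 2"
    using assms partial_fractions_inverse_powers[OF assms(2)] by (metis e)+
  have "3 * (U ^ 4 * V ^ (M - 2) + U ^ (M - 2) * V ^ 4)
       - of_nat (M - 2) * (U ^ 3 * V ^ (M - 1) + U ^ (M - 1) * V ^ 3)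
     = (\<Sum>i\<le>M. of_int (rec_coeff M i) * (U ^ Suc i * W ^ (M + 1 - i) + V ^ Suc i * W ^ (M + 1 - i)))"
    unfolding p pf_sum_def s sum.distrib[symmetric] sum_distrib_left sum_subtractf[symmetric]
    by (intro sum.cong refl) (simp add: rec_coeff_def Suc_diff_le algebra_simps)
  then show ?thesis
    by (simp only: sum_rec_coeff[OF assms(1)])
qed

section \<open>Recursion for lattice sums\<close>

text \<open>An additive subgroup without a chosen basis: the recursion rests on reindexing by
  \<open>u + v\<close> and on absolute convergence from exponent 3 on, both free of
  coordinates.\<close>

locale plane_lattice =
  fixes L :: "complex set"
  assumes zero_in: "0 \<in> L"
    and diff_in: "u \<in> L \<Longrightarrow> v \<in> L \<Longrightarrow> u - v \<in> L"
    and summable_cube: "(\<lambda>u. 1 / norm u ^ 3) summable_on L - {0}"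
begin

definition G :: "nat \<Rightarrow> complex" where
  "G k = (\<Sum>\<^sub>\<infinity>u\<in>L - {0}. 1 / u ^ k)"

lemma uminus_in: "u \<in> L \<Longrightarrow> - u \<in> L"
  using diff_in[OF zero_in] by simp

lemma add_in: "u \<in> L \<Longrightarrow> v \<in> L \<Longrightarrow> u + v \<in> L"
  using diff_in[OF _ uminus_in] by fastforce

lemma abs_summable_power:
  assumes "k \<ge> 3"
  shows "(\<lambda>u. norm (1 / u ^ k)) summable_on L - {0}"
proof (rule Infinite_Sum.abs_summable_on_comparison_test')
  \<comment> \<open>The total of the inverse cubes bounds each of them, hence bounds
    \<open>1 / norm u\<close> uniformly; it does the work of a minimal distance from 0.\<close>
  define S where "S = (\<Sum>\<^sub>\<infinity>u\<in>L - {0}. 1 / norm u ^ 3)"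
  have S: "1 / norm u ^ 3 \<le> S" if "u \<in> L - {0}" for u
    using finite_sum_le_infsum[OF summable_cube, of "{u}"] that by (simp add: S_def)
  have bound: "1 / norm u \<le> 1 + S" if "u \<in> L - {0}" for u
  proof (rule ccontr)
    assume *: "\<not> 1 / norm u \<le> 1 + S"
    have "S \<ge> 0" unfolding S_def by (intro infsum_nonneg) auto
    with * have "1 / norm u \<ge> 1" by linarith
    then have "1 / norm u \<le> (1 / norm u) ^ 3"
      by (intro self_le_power) auto
    also have "\<dots> \<le> S"
      using S[OF that] by (simp add: power_one_over)
    finally show False using * by linarith
  qed
  show "(\<lambda>u. (1 + S) ^ (k - 3) * (1 / norm u ^ 3)) summable_on L - {0}"
    by (intro summable_on_cmult_right summable_cube)
  fix u assume u: "u \<in> L - {0}"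
  have "norm (1 / u ^ k) = (1 / norm u) ^ (k - 3) * (1 / norm u) ^ 3"
    using assms by (simp add: norm_divide norm_power power_one_over flip: power_add)
  also have "\<dots> \<le> (1 + S) ^ (k - 3) * (1 / norm u) ^ 3"
    by (intro mult_right_mono power_mono bound u) auto
  finally show "norm (1 / u ^ k) \<le> (1 + S) ^ (k - 3) * (1 / norm u ^ 3)"
    by (simp add: power_one_over)
qed

lemma has_sum_G:
  assumes "k \<ge> 3"
  shows "((\<lambda>u. 1 / u ^ k) has_sum G k) (L - {0})"
  unfolding G_def using abs_summable_summable[OF abs_summable_power[OF assms]] by simp

lemma G_odd:
  assumes "odd k"
  shows "G k = 0"
proof -
  have "G k = (\<Sum>\<^sub>\<infinity>u\<in>L - {0}. - (1 / u ^ k))"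
    unfolding G_def using assms
    by (intro infsum_reindex_bij_witness[of _ uminus uminus]) (auto simp: uminus_in)
  also have "\<dots> = - G k"
    by (simp only: infsum_uminus G_def)
  finally show ?thesis by simp
qed

section \<open>Double sums over pairs of lattice points\<close>

lemma abs_summable_pair:
  assumes "a \<ge> 3" "b \<ge> 3"
  shows "(\<lambda>x. norm (case x of (u, v) \<Rightarrow> 1 / (u ^ a * v ^ b))) summable_on (L - {0}) \<times> (L - {0})"
proof (subst Infinite_Sum.abs_summable_on_Sigma_iff, intro conjI ballI)
  show "(\<lambda>v. norm (case (u, v) of (u, v) \<Rightarrow> 1 / (u ^ a * v ^ b))) summable_on L - {0}" for u
    using summable_on_cmult_right[OF abs_summable_power[OF assms(2)], of "1 / norm u ^ a"]
    by (simp add: norm_divide norm_mult norm_power)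
  show "(\<lambda>u. norm (\<Sum>\<^sub>\<infinity>v\<in>L - {0}. norm (case (u, v) of (u, v) \<Rightarrow> 1 / (u ^ a * v ^ b))))
      summable_on L - {0}"
  proof (rule Infinite_Sum.abs_summable_on_comparison_test')
    show "(\<lambda>u. norm (1 / u ^ a) * (\<Sum>\<^sub>\<infinity>v\<in>L - {0}. norm (1 / v ^ b))) summable_on L - {0}"
      by (intro summable_on_cmult_left abs_summable_power assms)
    show "norm (\<Sum>\<^sub>\<infinity>v\<in>L - {0}. norm (case (u, v) of (u, v) \<Rightarrow> 1 / (u ^ a * v ^ b)))
        \<le> norm (1 / u ^ a) * (\<Sum>\<^sub>\<infinity>v\<in>L - {0}. norm (1 / v ^ b))" for u
      by (simp add: infsum_cmult_right'[symmetric] norm_divide norm_mult norm_power abs_of_nonneg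
          infsum_nonneg)
  qed
qed

lemma has_sum_pair:
  assumes "a \<ge> 3" "b \<ge> 3"
  shows "((\<lambda>(u, v). 1 / (u ^ a * v ^ b)) has_sum G a * G b) ((L - {0}) \<times> (L - {0}))"
proof (rule has_sum_SigmaI)
  show "((\<lambda>v. case (u, v) of (u, v) \<Rightarrow> 1 / (u ^ a * v ^ b)) has_sum 1 / u ^ a * G b) (L - {0})" for u
    using has_sum_cmult_right[OF has_sum_G[OF assms(2)], of "1 / u ^ a"] by simp
  show "((\<lambda>u. 1 / u ^ a * G b) has_sum G a * G b) (L - {0})"
    by (intro has_sum_cmult_left has_sum_G assms)
qed (rule abs_summable_summable[OF abs_summable_pair[OF assms]])

text \<open>The sum over all pairs splits at the line \<open>v = s * u\<close>, where the term is
  \<open>s ^ b / u ^ (a + b)\<close> because \<open>s\<close> is its own inverse. The case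
  \<open>s = -1\<close> removes \<open>u + v = 0\<close>; the case \<open>s = 1\<close> arises from
  the substitution \<open>w = u + v\<close>.\<close>

lemma has_sum_pair_off_line:
  assumes "a \<ge> 3" "b \<ge> 3" and s: "s = 1 \<or> s = -1"
  shows "((\<lambda>(u, v). 1 / (u ^ a * v ^ b)) has_sum G a * G b - s ^ b * G (a + b))
    {(u, v). u \<in> L - {0} \<and> v \<in> L - {0} \<and> v \<noteq> s * u}" (is "(?F has_sum _) ?P")
proof -
  let ?Q = "(\<lambda>u. (u, s * u)) ` (L - {0})"
  have ss: "s ^ b * s ^ b = 1" "s \<noteq> 0"
    using s by (auto simp: power_mult_distrib[symmetric])
  have "(?F has_sum s ^ b * G (a + b)) ?Q"
  proof (subst has_sum_reindex)
    have "((\<lambda>u. s ^ b * (1 / u ^ (a + b))) has_sum s ^ b * G (a + b)) (L - {0})"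
      using assms by (intro has_sum_cmult_right has_sum_G) auto
    also have "?this \<longleftrightarrow> (?F \<circ> (\<lambda>u. (u, s * u)) has_sum s ^ b * G (a + b)) (L - {0})"
      using ss by (intro has_sum_cong) (simp add: power_mult_distrib power_add field_simps)
    finally show "(?F \<circ> (\<lambda>u. (u, s * u)) has_sum s ^ b * G (a + b)) (L - {0})" .
  qed (auto simp: inj_on_def)
  moreover have "?F summable_on ?P"
    by (rule summable_on_subset[OF abs_summable_summable[OF abs_summable_pair[OF assms(1,2)]]]) auto
  then have P: "(?F has_sum infsum ?F ?P) ?P"
    by simp
  ultimately have "(?F has_sum infsum ?F ?P + s ^ b * G (a + b)) (?P \<union> ?Q)"
    by (intro has_sum_Un_disjoint) auto
  moreover have "?P \<union> ?Q = (L - {0}) \<times> (L - {0})"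
    using s by (auto simp: uminus_in)
  ultimately have "(?F has_sum infsum ?F ?P + s ^ b * G (a + b)) ((L - {0}) \<times> (L - {0}))"
    by simp
  then have "infsum ?F ?P + s ^ b * G (a + b) = G a * G b"
    using has_sum_pair[OF assms(1,2)] by (rule has_sum_unique)
  then have "infsum ?F ?P = G a * G b - s ^ b * G (a + b)"
    by (simp add: algebra_simps)
  with P show ?thesis
    by simp
qed

text \<open>Put \<open>w = u + v\<close>. In the pair \<open>(u, w)\<close> the condition
  \<open>v \<noteq> 0\<close> reads \<open>w \<noteq> u\<close>, and in \<open>(v, w)\<close> the
  condition \<open>u \<noteq> 0\<close> reads \<open>w \<noteq> v\<close>; both sums become the case
  \<open>s = 1\<close> of \<open>has_sum_pair_off_line\<close>.\<close>

lemma has_sum_pair_add: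
  assumes "a \<ge> 3" "b \<ge> 3"
  defines "P \<equiv> {(u, v). u \<in> L - {0} \<and> v \<in> L - {0} \<and> v \<noteq> - 1 * u}"
  shows "((\<lambda>(u, v). 1 / (u ^ a * (u + v) ^ b)) has_sum G a * G b - G (a + b)) P"
    and "((\<lambda>(u, v). 1 / (v ^ a * (u + v) ^ b)) has_sum G a * G b - G (a + b)) P"
proof -
  let ?Q = "{(u, w). u \<in> L - {0} \<and> w \<in> L - {0} \<and> w \<noteq> 1 * u}"
  have Q: "((\<lambda>(u, w). 1 / (u ^ a * w ^ b)) has_sum G a * G b - G (a + b)) ?Q"
    using has_sum_pair_off_line[OF assms(1,2), of 1] by simp
  have "bij_betw (\<lambda>(u, v). (u, u + v)) P ?Q"
    by (rule bij_betwI[of _ _ _ "\<lambda>(u, w). (u, w - u)"])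
       (auto simp: P_def add_in diff_in add_eq_0_iff)
  from has_sum_reindex_bij_betw[OF this, THEN iffD2, OF Q]
  show "((\<lambda>(u, v). 1 / (u ^ a * (u + v) ^ b)) has_sum G a * G b - G (a + b)) P"
    by (simp add: case_prod_unfold)
  have "bij_betw (\<lambda>(u, v). (v, u + v)) P ?Q"
    by (rule bij_betwI[of _ _ _ "\<lambda>(v, w). (w - v, v)"])
       (auto simp: P_def add_in diff_in add_eq_0_iff2)
  from has_sum_reindex_bij_betw[OF this, THEN iffD2, OF Q]
  show "((\<lambda>(u, v). 1 / (v ^ a * (u + v) ^ b)) has_sum G a * G b - G (a + b)) P"
    by (simp add: case_prod_unfold)
qed

text \<open>Both sides of \<open>rec_coeff_partial_fractions\<close> are summed over the pairs with
  \<open>u\<close>, \<open>v\<close> and \<open>u + v\<close> nonzero, and the results are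
  equated.\<close>

lemma G_recursion:
  assumes "M \<ge> 6" "even M"
  shows "of_int (int M + 1 - (\<Sum>i=2..M - 2. rec_coeff M i)) * G (M + 2)
    = 3 * G 4 * G (M - 2) - (\<Sum>i=2..M - 2. of_int (rec_coeff M i) * (G (Suc i) * G (M + 1 - i)))"
proof -
  define P where "P = {(u, v). u \<in> L - {0} \<and> v \<in> L - {0} \<and> v \<noteq> - 1 * u}"
  have off: "((\<lambda>(u, v). 1 / (u ^ a * v ^ b)) has_sum G a * G b - (- 1) ^ b * G (a + b)) P"
    if "a \<ge> 3" "b \<ge> 3" for a b
    using has_sum_pair_off_line[OF that, of "- 1"] by (simp add: P_def)
  let ?l = "\<lambda>x. 3 * ((case x of (u, v) \<Rightarrow> 1 / (u ^ 4 * v ^ (M - 2)))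
      + (case x of (u, v) \<Rightarrow> 1 / (u ^ (M - 2) * v ^ 4)))
    - of_nat (M - 2) * ((case x of (u, v) \<Rightarrow> 1 / (u ^ 3 * v ^ (M - 1)))
        + (case x of (u, v) \<Rightarrow> 1 / (u ^ (M - 1) * v ^ 3)))"
  let ?r = "\<lambda>x. \<Sum>i=2..M - 2. of_int (rec_coeff M i) *
    ((case x of (u, v) \<Rightarrow> 1 / (u ^ Suc i * (u + v) ^ (M + 1 - i)))
        + (case x of (u, v) \<Rightarrow> 1 / (v ^ Suc i * (u + v) ^ (M + 1 - i))))"
  let ?A = "3 * ((G 4 * G (M - 2) - (- 1) ^ (M - 2) * G (4 + (M - 2)))
        + (G (M - 2) * G 4 - (- 1) ^ 4 * G (M - 2 + 4)))
    - of_nat (M - 2) * ((G 3 * G (M - 1) - (- 1) ^ (M - 1) * G (3 + (M - 1)))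
        + (G (M - 1) * G 3 - (- 1) ^ 3 * G (M - 1 + 3)))"
  let ?B = "\<Sum>i=2..M - 2. of_int (rec_coeff M i) *
    ((G (Suc i) * G (M + 1 - i) - G (Suc i + (M + 1 - i)))
      + (G (Suc i) * G (M + 1 - i) - G (Suc i + (M + 1 - i))))"
  have l: "(?l has_sum ?A) P"
    unfolding diff_conv_add_uminus[of "3 * _"] mult_minus_left[symmetric]
    using assms by (intro has_sum_cmult_right has_sum_add off) auto
  have r: "(?r has_sum ?B) P"
    unfolding P_def using assms
    by (intro has_sum_finite_sum has_sum_cmult_right has_sum_add has_sum_pair_add) auto
  have lr: "?l x = ?r x" if x: "x \<in> P" for x
  proof -
    obtain u v where uv: "x = (u, v)" "u \<noteq> 0" "v \<noteq> 0" "u + v \<noteq> 0"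
      using x by (cases x) (auto simp: P_def add_eq_0_iff)
    then have "(1 / u) * (1 / v) = 1 / (u + v) * (1 / u + 1 / v)"
      by (simp add: field_simps)
    from rec_coeff_partial_fractions[OF assms(1) this] show ?thesis
      by (simp add: uv power_one_over)
  qed
  have "(?r has_sum ?A) P"
    using l by (subst has_sum_cong[OF lr[symmetric]])
  from this r have "?A = ?B"
    by (rule has_sum_unique)
  \<comment> \<open>The products with \<open>G 3\<close> vanish. Up to the common factor 2, the
    removed line contributes 3 and \<open>M - 2\<close> times \<open>G (M + 2)\<close> with the same
    sign; this is the \<open>M + 1\<close> of the statement.\<close>
  moreover have "?A = 6 * (G 4 * G (M - 2) - G (M + 2)) - 2 * of_nat (M - 2) * G (M + 2)"
  proof -
    have "4 + (M - 2) = M + 2" "M - 2 + 4 = M + 2" "3 + (M - 1) = M + 2" "M - 1 + 3 = M + 2"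
      "even (M - 2)" "odd (M - 1)"
      using assms by simp_all
    then show ?thesis
      by (simp add: G_odd algebra_simps)
  qed
  moreover have "?B = 2 * (\<Sum>i=2..M - 2. of_int (rec_coeff M i) * (G (Suc i) * G (M + 1 - i)))
      - 2 * of_int (\<Sum>i=2..M - 2. rec_coeff M i) * G (M + 2)"
  proof -
    have "?B = (\<Sum>i=2..M - 2. 2 * (of_int (rec_coeff M i) * (G (Suc i) * G (M + 1 - i)))
      - 2 * of_int (rec_coeff M i) * G (M + 2))"
      by (intro sum.cong refl) (auto simp: algebra_simps)
    then show ?thesis
      by (simp add: sum_subtractf sum_distrib_left sum_distrib_right mult.assoc)
  qed
  ultimately have "6 * (G 4 * G (M - 2) - G (M + 2)) - 2 * of_nat (M - 2) * G (M + 2) =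
      2 * (\<Sum>i=2..M - 2. of_int (rec_coeff M i) * (G (Suc i) * G (M + 1 - i)))
      - 2 * of_int (\<Sum>i=2..M - 2. rec_coeff M i) * G (M + 2)"
    by simp
  moreover have "(of_nat (M - 2) :: complex) = of_nat M - 2"
    using assms by (simp add: of_nat_diff)
  ultimately have "2 * (of_int (int M + 1 - (\<Sum>i=2..M - 2. rec_coeff M i)) * G (M + 2))
    = 2 * (3 * G 4 * G (M - 2)
        - (\<Sum>i=2..M - 2. of_int (rec_coeff M i) * (G (Suc i) * G (M + 1 - i))))"
    by (simp add: algebra_simps del: of_int_sum)
  then show ?thesis
    by (simp only: mult_cancel_left) simp
qed

end

section \<open>The series of the squared cosecant\<close>

abbreviation (input) cpi :: complex where "cpi \<equiv> complex_of_real pi"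

definition cosec_series :: "nat \<Rightarrow> complex \<Rightarrow> complex" where
  "cosec_series p z = (\<Sum>\<^sub>\<infinity>n::int. 1 / (z + of_int n) ^ (2 * p))"

definition cosec_sq :: "complex \<Rightarrow> complex" where
  "cosec_sq z = (cpi / sin (cpi * z)) ^ 2"

lemma not_nonpos_Int_if_not_Int:
  fixes z :: complex
  assumes "z \<notin> \<int>"
  shows "z \<notin> \<int>\<^sub>\<le>\<^sub>0" "1 - z \<notin> \<int>\<^sub>\<le>\<^sub>0" "sin (cpi * z) \<noteq> 0"
proof -
  show "z \<notin> \<int>\<^sub>\<le>\<^sub>0"
    using assms nonpos_Ints_Int by blast
  show "1 - z \<notin> \<int>\<^sub>\<le>\<^sub>0"
  proof
    assume "1 - z \<in> \<int>\<^sub>\<le>\<^sub>0"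
    then have "1 - (1 - z) \<in> \<int>"
      by (intro Ints_diff Ints_1 nonpos_Ints_Int)
    with assms show False by simp
  qed
  show "sin (cpi * z) \<noteq> 0"
    using assms by (auto simp: sin_eq_0 mult.commute)
qed

text \<open>The Polygamma series comes as an ordered one. Comparison with \<open>1 / k ^ 2\<close>
  turns it into an unordered sum, which allows two halves of the integers to be glued.\<close>

lemma has_sum_inverse_power_nat:
  fixes z :: complex
  assumes "z \<noteq> 0" "n > 0"
  shows "((\<lambda>k::nat. 1 / (z + of_nat k) ^ Suc n) has_sum ((-1) ^ Suc n * Polygamma n z / fact n))
      UNIV"
proof -
  have "summable (\<lambda>k. 1 / (real k) ^ 2)"
    using inverse_power_summable[of 2, where 'a = real] by (simp add: inverse_eq_divide)
  then have "summable (\<lambda>k. 2 ^ Suc n * (1 / (real k) ^ 2))"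
    by (rule summable_mult)
  moreover have "\<forall>\<^sub>F k in sequentially. norm (norm (1 / (z + of_nat k) ^ Suc n))
      \<le> 2 ^ Suc n * (1 / (real k) ^ 2)"
    \<comment> \<open>Beyond this bound \<open>norm z\<close> is at most \<open>k / 2\<close>, hence
      \<open>norm (z + of_nat k) \<ge> k / 2\<close>.\<close>
    using eventually_gt_at_top[of "nat \<lceil>2 * norm z + 1\<rceil>"]
  proof eventually_elim
    case (elim k)
    then have k: "real k > 2 * norm z + 1" "real k \<ge> 1"
      by linarith+
    have "real k = norm ((z + of_nat k) - z)" by simp
    also have "\<dots> \<le> norm (z + of_nat k) + norm z"
      by (rule norm_triangle_ineq4)
    finally have *: "norm (z + of_nat k) \<ge> real k / 2"
      using k by linarith
    have "norm (1 / (z + of_nat k) ^ Suc n) = 1 / norm (z + of_nat k) ^ Suc n"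
      by (simp add: norm_divide norm_power norm_mult)
    also have "\<dots> \<le> 1 / (real k / 2) ^ Suc n"
      using * k by (intro divide_left_mono power_mono mult_pos_pos zero_less_power) auto
    also have "\<dots> = 2 ^ Suc n * (1 / real k ^ Suc n)"
      by (simp add: power_divide)
    also have "\<dots> \<le> 2 ^ Suc n * (1 / real k ^ 2)"
      using k assms by (intro mult_left_mono divide_left_mono power_increasing) auto
    finally show ?case by simp
  qed
  ultimately have "summable (\<lambda>k. norm (1 / (z + of_nat k) ^ Suc n))"
    by (rule summable_comparison_test_ev[rotated])
  moreover have "(\<lambda>k. 1 / (z + of_nat k) ^ Suc n) sums ((-1) ^ Suc n * Polygamma n z / fact n)"
    using Polygamma_LIMSEQ[OF assms] by (simp add: inverse_eq_divide)
  ultimately show ?thesis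
    by (rule norm_summable_imp_has_sum)
qed

text \<open>The negative half is indexed by \<open>- int k - 1\<close> because
  \<open>z - k - 1 = - (1 - z + k)\<close> leads to the same series at \<open>1 - z\<close>.\<close>

lemma UNIV_int_split: "(UNIV :: int set) = range int \<union> range (\<lambda>k. - int k - 1)"
proof -
  have "i \<in> range int \<union> range (\<lambda>k. - int k - 1)" for i
  proof (cases "i \<ge> 0")
    case True
    then have "i = int (nat i)" by simp
    then show ?thesis by blast
  next
    case False
    then have "i = - int (nat (- i - 1)) - 1" by simp
    then show ?thesis by blast
  qed
  then show ?thesis by auto
qed

text \<open>The sign compensates the inner derivative of \<open>1 - z\<close>, so each derivative
  just raises \<open>k\<close>. Off the integers, for odd \<open>k\<close> this is
  \<open>fact k\<close> times the series over all integers; for \<open>k = 0\<close> it is the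
  difference in the reflection formula.\<close>

definition polygamma_sum :: "nat \<Rightarrow> complex \<Rightarrow> complex" where
  "polygamma_sum k z = Polygamma k z + (- 1) ^ Suc k * Polygamma k (1 - z)"

lemma has_sum_cosec_series_aux:
  assumes z: "z \<notin> \<int>" and p: "p \<ge> 1"
  shows "((\<lambda>n::int. 1 / (z + of_int n) ^ (2 * p))
      has_sum polygamma_sum (2 * p - 1) z / fact (2 * p - 1)) UNIV"
proof -
  define n where "n = 2 * p - 1"
  have n: "n > 0" "2 * p = Suc n" "odd n" "2 * p - 1 = n"
    using p by (auto simp: n_def)
  have nz: "z \<noteq> 0" "1 - z \<noteq> 0"
    using not_nonpos_Int_if_not_Int[OF z] by auto
  have "((\<lambda>k::int. 1 / (z + of_int k) ^ Suc n) has_sum Polygamma n z / fact n) (range int)"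
    using has_sum_inverse_power_nat[OF nz(1) n(1)] n by (subst has_sum_reindex) (auto simp: o_def)
  moreover have "((\<lambda>k::int. 1 / (z + of_int k) ^ Suc n) has_sum Polygamma n (1 - z) / fact n)
      (range (\<lambda>k. - int k - 1))"
  proof (subst has_sum_reindex)
    have "(z + of_int (- int k - 1)) ^ Suc n = (1 - z + of_nat k) ^ Suc n" for k
    proof -
      have "z + of_int (- int k - 1) = - (1 - z + of_nat k)" by simp
      then show ?thesis
        using n(3) by (simp only: power_minus_even even_Suc not_False_eq_True)
    qed
    then show "((\<lambda>k::int. 1 / (z + of_int k) ^ Suc n) \<circ> (\<lambda>k. - int k - 1)
        has_sum Polygamma n (1 - z) / fact n) UNIV"
      using has_sum_inverse_power_nat[OF nz(2) n(1)] n(3) by (simp only: o_def) simp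
  qed (auto simp: inj_def)
  ultimately have "((\<lambda>k::int. 1 / (z + of_int k) ^ Suc n)
      has_sum (Polygamma n z / fact n + Polygamma n (1 - z) / fact n)) UNIV"
    unfolding UNIV_int_split by (rule has_sum_Un_disjoint) auto
  then show ?thesis
    using n by (simp add: polygamma_sum_def add_divide_distrib)
qed

lemma cosec_series_eq_polygamma:
  assumes "z \<notin> \<int>" "p \<ge> 1"
  shows "cosec_series p z = polygamma_sum (2 * p - 1) z / fact (2 * p - 1)"
  unfolding cosec_series_def using has_sum_cosec_series_aux[OF assms] by (rule infsumI)

lemma has_sum_cosec_series:
  assumes "z \<notin> \<int>" "p \<ge> 1"
  shows "((\<lambda>n::int. 1 / (z + of_int n) ^ (2 * p)) has_sum cosec_series p z) UNIV"
  using has_sum_cosec_series_aux[OF assms] by (simp add: cosec_series_eq_polygamma[OF assms])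

lemma has_field_derivative_polygamma_sum:
  assumes "z \<notin> \<int>"
  shows "(polygamma_sum k has_field_derivative polygamma_sum (Suc k) z) (at z)"
  unfolding polygamma_sum_def using not_nonpos_Int_if_not_Int[OF assms]
  by (auto intro!: derivative_eq_intros)

lemma open_Compl_Ints: "open (- \<int> :: complex set)"
  by (simp add: closed_Ints open_Compl)

lemma has_field_derivative_transform_not_Int:
  fixes f g :: "complex \<Rightarrow> complex"
  assumes "(f has_field_derivative d) (at z)" "z \<notin> \<int>" "\<And>w. w \<notin> \<int> \<Longrightarrow> f w = g w"
  shows "(g has_field_derivative d) (at z)"
  by (rule has_field_derivative_transform_within_open[OF assms(1) open_Compl_Ints])
      (use assms in auto)

text \<open>Logarithmic derivative of the reflection formula
  \<open>rGamma z * rGamma (1 - z) = sin (\<pi> * z) / \<pi>\<close>.\<close>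

lemma digamma_reflection:
  assumes "z \<notin> \<int>"
  shows "polygamma_sum 0 z = - cpi * cos (cpi * z) / sin (cpi * z)"
proof -
  note nz = not_nonpos_Int_if_not_Int[OF assms]
  have "((\<lambda>w. rGamma w * rGamma (1 - w)) has_field_derivative
      - rGamma z * rGamma (1 - z) * polygamma_sum 0 z) (at z)"
    using nz by (auto intro!: derivative_eq_intros simp: polygamma_sum_def algebra_simps)
  then have "((\<lambda>w. sin (cpi * w) / cpi) has_field_derivative
      - rGamma z * rGamma (1 - z) * polygamma_sum 0 z) (at z)"
    by (simp add: rGamma_reflection_complex)
  moreover have "((\<lambda>w. sin (cpi * w) / cpi) has_field_derivative
      cos (cpi * z)) (at z)"
    by (auto intro!: derivative_eq_intros)
  ultimately have "- (rGamma z * rGamma (1 - z)) * polygamma_sum 0 z = cos (cpi * z)"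
    by (auto dest: DERIV_unique)
  then have *: "cos (cpi * z) = - (sin (cpi * z) / cpi) * polygamma_sum 0 z"
    by (simp only: rGamma_reflection_complex)
  show ?thesis
    using nz by (simp add: *)
qed

lemma cosec_series_1:
  assumes "z \<notin> \<int>"
  shows "cosec_series 1 z = cosec_sq z"
proof -
  note nz = not_nonpos_Int_if_not_Int[OF assms]
  have "((\<lambda>w. - cpi * cos (cpi * w) / sin (cpi * w))
      has_field_derivative polygamma_sum 1 z) (at z)"
    using has_field_derivative_polygamma_sum[OF assms, of 0] unfolding One_nat_def
    by (rule has_field_derivative_transform_not_Int) (use assms digamma_reflection in auto)
  moreover have "((\<lambda>w. - cpi * cos (cpi * w) / sin (cpi * w))
      has_field_derivative cosec_sq z) (at z)"
  proof -
    have "((\<lambda>w. - cpi * cos (cpi * w) / sin (cpi * w))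
      has_field_derivative cpi ^ 2 * (sin (cpi * z) ^ 2 + cos (cpi * z) ^ 2)
        / sin (cpi * z) ^ 2) (at z)"
      using nz by (auto intro!: derivative_eq_intros
        simp: power2_eq_square divide_simps algebra_simps simp del: sin_cos_squared_add
            sin_cos_squared_add2 sin_cos_squared_add3)
    then show ?thesis
      by (simp only: sin_cos_squared_add mult_1_right cosec_sq_def power_divide)
  qed
  ultimately have "polygamma_sum 1 z = cosec_sq z"
    by (rule DERIV_unique)
  then show ?thesis
    using cosec_series_eq_polygamma[OF assms, of 1] by simp
qed

text \<open>One derivative of a polynomial in \<open>cosec_sq\<close> carries a factor cosine, so
  derivatives are taken in pairs and the first one stays an anonymous witness.\<close>

definition second_derivative :: "(complex \<Rightarrow> complex) \<Rightarrow> (complex \<Rightarrow> complex) \<Rightarrow> bool" where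
  "second_derivative f g \<longleftrightarrow> (\<exists>f'. \<forall>z. z \<notin> \<int> \<longrightarrow>
     (f has_field_derivative f' z) (at z) \<and> (f' has_field_derivative g z) (at z))"

text \<open>Serves to compare two expressions for one function after differentiation. The complement
  of the integers is open, so equality there passes to derivatives.\<close>

lemma second_derivative_unique:
  assumes "second_derivative f f''" "second_derivative g g''"
    and "\<And>z. z \<notin> \<int> \<Longrightarrow> f z = g z" "z \<notin> \<int>"
  shows "f'' z = g'' z"
proof -
  obtain f' where f: "\<And>z. z \<notin> \<int> \<Longrightarrow> (f has_field_derivative f' z) (at z)"
    "\<And>z. z \<notin> \<int> \<Longrightarrow> (f' has_field_derivative f'' z) (at z)"
    using assms(1) unfolding second_derivative_def by blast
  obtain g' where g: "\<And>z. z \<notin> \<int> \<Longrightarrow> (g has_field_derivative g' z) (at z)"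
    "\<And>z. z \<notin> \<int> \<Longrightarrow> (g' has_field_derivative g'' z) (at z)"
    using assms(2) unfolding second_derivative_def by blast
  have "f' w = g' w" if "w \<notin> \<int>" for w
    by (rule DERIV_unique[OF has_field_derivative_transform_not_Int[OF f(1)] g(1)])
        (use that assms(3) in auto)
  then show ?thesis
    by (intro DERIV_unique[OF has_field_derivative_transform_not_Int[OF f(2)] g(2)])
        (use assms(4) in auto)
qed

text \<open>This is the termwise second derivative; the detour through \<open>polygamma_sum\<close>
  avoids differentiating an infinite sum.\<close>

lemma second_derivative_cosec_series:
  assumes "p \<ge> 1"
  shows "second_derivative (cosec_series p)
      (\<lambda>z. of_nat (2 * p * (2 * p + 1)) * cosec_series (Suc p) z)"
  unfolding second_derivative_def
proof (intro exI[of _ "\<lambda>z. polygamma_sum (2 * p) z / fact (2 * p - 1)"] allI impI conjI)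
  fix z :: complex assume z: "z \<notin> \<int>"
  have s: "Suc (2 * p - 1) = 2 * p" using assms by simp
  have "((\<lambda>z. polygamma_sum (2 * p - 1) z / fact (2 * p - 1))
      has_field_derivative polygamma_sum (2 * p) z / fact (2 * p - 1)) (at z)"
    using has_field_derivative_polygamma_sum[OF z, of "2 * p - 1"]
      by (intro DERIV_cdivide) (simp only: s)
  then show "(cosec_series p has_field_derivative polygamma_sum (2 * p) z / fact (2 * p - 1))
      (at z)"
    by (rule has_field_derivative_transform_not_Int) (use z assms cosec_series_eq_polygamma in auto)
  have "fact (2 * p + 1) = (of_nat (2 * p * (2 * p + 1)) * fact (2 * p - 1) :: complex)"
    using assms fact_reduce[of "2 * p", where 'a = complex] by (simp add: algebra_simps)
  then have "of_nat (2 * p * (2 * p + 1)) * cosec_series (Suc p) z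
      = polygamma_sum (Suc (2 * p)) z / fact (2 * p - 1)"
    using cosec_series_eq_polygamma[OF z, of "Suc p"] assms
    by (simp add: field_simps del: of_nat_mult of_nat_add fact_Suc)
  then show "((\<lambda>z. polygamma_sum (2 * p) z / fact (2 * p - 1)) has_field_derivative
      of_nat (2 * p * (2 * p + 1)) * cosec_series (Suc p) z) (at z)"
    using has_field_derivative_polygamma_sum[OF z, of "2 * p"] DERIV_cdivide by metis
qed

text \<open>With \<open>X = cosec_sq\<close>, the two fixed polynomials encode
  \<open>(X')^2 = 4 X^3 - 4 \<pi>^2 X^2\<close> and \<open>X'' = 6 X^2 - 4 \<pi>^2 X\<close>; the
  rest is the chain rule.\<close>

lemma second_derivative_poly_cosec_sq:
  "second_derivative (\<lambda>z. poly P (cosec_sq z))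
    (\<lambda>z. poly (pderiv (pderiv P) * [:0, 0, - 4 * cpi ^ 2, 4:]
              + pderiv P * [:0, - 4 * cpi ^ 2, 6:]) (cosec_sq z))"
  unfolding second_derivative_def
proof (intro exI[of _ "\<lambda>z. poly (pderiv P) (cosec_sq z) *
      (- 2 * cpi ^ 3 * cos (cpi * z) / sin (cpi * z) ^ 3)"] allI impI conjI)
  fix z :: complex assume z: "z \<notin> \<int>"
  define s c where "s = sin (cpi * z)" and "c = cos (cpi * z)"
  have nz: "s \<noteq> 0" and c2: "c ^ 2 = 1 - s ^ 2"
    using not_nonpos_Int_if_not_Int[OF z] by (simp_all add: s_def c_def cos_squared_eq)
  have X: "(cosec_sq has_field_derivative - 2 * cpi ^ 3 * c / s ^ 3) (at z)"
    unfolding cosec_sq_def s_def c_def using nz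
    by (auto intro!: derivative_eq_intros simp: s_def field_simps power2_eq_square power3_eq_cube)
  then show "((\<lambda>z. poly P (cosec_sq z)) has_field_derivative poly (pderiv P) (cosec_sq z) *
      (- 2 * cpi ^ 3 * cos (cpi * z) / sin (cpi * z) ^ 3)) (at z)"
    unfolding s_def c_def by (intro DERIV_chain2[OF poly_DERIV])
  have Y: "((\<lambda>z. - 2 * cpi ^ 3 * cos (cpi * z) / sin (cpi * z) ^ 3)
      has_field_derivative 2 * cpi ^ 4 * (s ^ 2 + 3 * c ^ 2) / s ^ 4) (at z)"
    using nz unfolding s_def c_def
    by (auto intro!: derivative_eq_intros simp: divide_simps)
        (simp add: algebra_simps eval_nat_numeral)
  have "((\<lambda>z. poly (pderiv P) (cosec_sq z) *
      (- 2 * cpi ^ 3 * cos (cpi * z) / sin (cpi * z) ^ 3))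
    has_field_derivative poly (pderiv P) (cosec_sq z) * (2 * cpi ^ 4 * (s ^ 2 + 3 * c ^ 2) / s ^ 4)
     + poly (pderiv (pderiv P)) (cosec_sq z) * (- 2 * cpi ^ 3 * c / s ^ 3) *
      (- 2 * cpi ^ 3 * cos (cpi * z) / sin (cpi * z) ^ 3)) (at z)"
    by (rule DERIV_mult'[OF DERIV_chain2[OF poly_DERIV X] Y])
  also have "poly (pderiv P) (cosec_sq z) * (2 * cpi ^ 4 * (s ^ 2 + 3 * c ^ 2) / s ^ 4)
     + poly (pderiv (pderiv P)) (cosec_sq z) * (- 2 * cpi ^ 3 * c / s ^ 3) *
      (- 2 * cpi ^ 3 * cos (cpi * z) / sin (cpi * z) ^ 3)
    = poly (pderiv P) (cosec_sq z) * (2 * cpi ^ 4 * (s ^ 2 + 3 * c ^ 2) / s ^ 4)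
     + poly (pderiv (pderiv P)) (cosec_sq z) * (4 * cpi ^ 6 * c ^ 2 / s ^ 6)"
    unfolding s_def[symmetric] c_def[symmetric] by (simp add: power_add[symmetric] power2_eq_square)
  also have "2 * cpi ^ 4 * (s ^ 2 + 3 * c ^ 2) / s ^ 4 = poly [:0, - 4 * cpi ^ 2, 6:] (cosec_sq z)"
    using nz unfolding c2 cosec_sq_def s_def[symmetric]
    by (simp add: field_simps)
  also have "4 * cpi ^ 6 * c ^ 2 / s ^ 6 = poly [:0, 0, - 4 * cpi ^ 2, 4:] (cosec_sq z)"
    using nz unfolding c2 cosec_sq_def s_def[symmetric]
    by (simp add: field_simps)
  finally show "((\<lambda>z. poly (pderiv P) (cosec_sq z) *
      (- 2 * cpi ^ 3 * cos (cpi * z) / sin (cpi * z) ^ 3))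
    has_field_derivative poly (pderiv (pderiv P) * [:0, 0, - 4 * cpi ^ 2, 4:]
              + pderiv P * [:0, - 4 * cpi ^ 2, 6:]) (cosec_sq z)) (at z)"
    by (simp only: poly_add poly_mult add.commute)
qed

section \<open>Coefficients in \<open>\<rat>[\<pi>\<^sup>2]\<close>\<close>

text \<open>Generated inductively, so that rule induction carries its elements into the ring of
  polynomial expressions.\<close>

inductive_set rat_pi_sq :: "complex set" where
  of_rat: "of_rat q \<in> rat_pi_sq"
| pi_sq: "cpi ^ 2 \<in> rat_pi_sq"
| add: "a \<in> rat_pi_sq \<Longrightarrow> b \<in> rat_pi_sq \<Longrightarrow> a + b \<in> rat_pi_sq"
| mult: "a \<in> rat_pi_sq \<Longrightarrow> b \<in> rat_pi_sq \<Longrightarrow> a * b \<in> rat_pi_sq"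

lemma rat_pi_sq_Rats: "a \<in> \<rat> \<Longrightarrow> a \<in> rat_pi_sq"
  by (auto elim!: Rats_cases intro: rat_pi_sq.of_rat)

lemma rat_pi_sq_sum: "(\<And>i. i \<in> I \<Longrightarrow> f i \<in> rat_pi_sq) \<Longrightarrow> sum f I \<in> rat_pi_sq"
  by (induction I rule: infinite_finite_induct) (auto intro: rat_pi_sq.add rat_pi_sq_Rats)

lemma rat_pi_sq_power: "a \<in> rat_pi_sq \<Longrightarrow> a ^ n \<in> rat_pi_sq"
  by (induction n) (auto intro: rat_pi_sq.mult rat_pi_sq_Rats)

lemma rat_pi_sq_prod_list: "(\<And>x. x \<in> set xs \<Longrightarrow> f x \<in> rat_pi_sq) \<Longrightarrow> (\<Prod>x\<leftarrow>xs. f x) \<in> rat_pi_sq"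
  by (induction xs) (auto intro: rat_pi_sq.mult rat_pi_sq_Rats)

lemma rat_pi_sq_diff: "a \<in> rat_pi_sq \<Longrightarrow> b \<in> rat_pi_sq \<Longrightarrow> a - b \<in> rat_pi_sq"
  using rat_pi_sq.add[of a "(- 1) * b"] rat_pi_sq.mult[OF rat_pi_sq_Rats[of "- 1"], of b] by simp

lemma rat_pi_sq_divide_Rats: "a \<in> rat_pi_sq \<Longrightarrow> b \<in> \<rat> \<Longrightarrow> a / b \<in> rat_pi_sq"
  using rat_pi_sq.mult[OF _ rat_pi_sq_Rats[of "inverse b"], of a] by (simp add: divide_inverse)

definition rat_pi_sq_poly :: "complex poly \<Rightarrow> bool" where
  "rat_pi_sq_poly P \<longleftrightarrow> (\<forall>i. coeff P i \<in> rat_pi_sq)"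

lemma rat_pi_sq_poly_0: "rat_pi_sq_poly 0"
  by (auto simp: rat_pi_sq_poly_def intro: rat_pi_sq_Rats)

lemma rat_pi_sq_poly_pCons: "a \<in> rat_pi_sq \<Longrightarrow> rat_pi_sq_poly P \<Longrightarrow> rat_pi_sq_poly (pCons a P)"
  by (auto simp: rat_pi_sq_poly_def coeff_pCons split: nat.split)

lemma rat_pi_sq_poly_add: "rat_pi_sq_poly P \<Longrightarrow> rat_pi_sq_poly Q \<Longrightarrow> rat_pi_sq_poly (P + Q)"
  by (auto simp: rat_pi_sq_poly_def intro: rat_pi_sq.add)

lemma rat_pi_sq_poly_mult: "rat_pi_sq_poly P \<Longrightarrow> rat_pi_sq_poly Q \<Longrightarrow> rat_pi_sq_poly (P * Q)"
  by (auto simp: rat_pi_sq_poly_def coeff_mult intro!: rat_pi_sq_sum rat_pi_sq.mult)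

lemma rat_pi_sq_poly_smult: "a \<in> rat_pi_sq \<Longrightarrow> rat_pi_sq_poly P \<Longrightarrow> rat_pi_sq_poly (smult a P)"
  by (auto simp: rat_pi_sq_poly_def intro: rat_pi_sq.mult)

lemma rat_pi_sq_poly_pderiv: "rat_pi_sq_poly P \<Longrightarrow> rat_pi_sq_poly (pderiv P)"
  unfolding rat_pi_sq_poly_def coeff_pderiv
    by (auto intro!: rat_pi_sq.mult rat_pi_sq_Rats[of "of_nat _"] simp del: of_nat_Suc)

lemmas rat_pi_sq_poly_intros = rat_pi_sq_poly_0 rat_pi_sq_poly_pCons rat_pi_sq_poly_add
  rat_pi_sq_poly_mult rat_pi_sq_poly_smult rat_pi_sq_poly_pderiv

text \<open>Two derivatives take \<open>cosec_series p\<close> to a nonzero rational multiple of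
  \<open>cosec_series (Suc p)\<close>, and polynomials in \<open>cosec_sq\<close> to such
  polynomials. The constant term has to vanish because a nonzero constant cannot be summed over
  \<open>m\<close>.\<close>

lemma cosec_series_eq_poly:
  assumes "p \<ge> 1"
  shows "\<exists>P. rat_pi_sq_poly P \<and> coeff P 0 = 0 \<and>
    (\<forall>z. z \<notin> \<int> \<longrightarrow> cosec_series p z = poly P (cosec_sq z))"
  using assms
proof (induction p rule: nat_induct_at_least)
  case base
  show ?case
    by (rule exI[of _ "[:0, 1:]"])
        (use cosec_series_1 in \<open>auto intro!: rat_pi_sq_poly_intros rat_pi_sq_Rats\<close>)
next
  case (Suc p)
  then obtain P where P: "rat_pi_sq_poly P" "\<And>z. z \<notin> \<int> \<Longrightarrow> cosec_series p z = poly P (cosec_sq z)"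
    by blast
  define Q where "Q = pderiv (pderiv P) * [:0, 0, - 4 * cpi ^ 2, 4:]
              + pderiv P * [:0, - 4 * cpi ^ 2, 6:]"
  have eq: "of_nat (2 * p * (2 * p + 1)) * cosec_series (Suc p) z = poly Q (cosec_sq z)" if "z \<notin> \<int>"
      for z
    using second_derivative_unique[OF second_derivative_cosec_series[OF Suc.hyps]
        second_derivative_poly_cosec_sq P(2) that]
    by (simp add: Q_def)
  have "- 4 * cpi ^ 2 \<in> rat_pi_sq"
    by (intro rat_pi_sq.mult rat_pi_sq.pi_sq rat_pi_sq_Rats) auto
  then have "rat_pi_sq_poly Q"
    unfolding Q_def using P by (intro rat_pi_sq_poly_intros) (auto intro: rat_pi_sq_Rats)
  moreover have "coeff Q 0 = 0"
    by (simp add: Q_def coeff_mult_0)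
  moreover have "cosec_series (Suc p) z
      = poly (smult (1 / of_nat (2 * p * (2 * p + 1))) Q) (cosec_sq z)" if "z \<notin> \<int>" for z
    using Suc.hyps by (simp add: eq[OF that, symmetric] del: of_nat_mult of_nat_add)
  ultimately show ?case
    by (intro exI[of _ "smult (1 / of_nat (2 * p * (2 * p + 1))) Q"])
       (auto intro!: rat_pi_sq_poly_smult rat_pi_sq_Rats simp del: of_nat_mult of_nat_add)
qed

lemma second_derivative_sum:
  assumes "\<And>i. i \<in> I \<Longrightarrow> second_derivative (f i) (g i)"
  shows "second_derivative (\<lambda>z. \<Sum>i\<in>I. c i * f i z) (\<lambda>z. \<Sum>i\<in>I. c i * g i z)"
proof -
  obtain f' where "\<And>i z. i \<in> I \<Longrightarrow> z \<notin> \<int> \<Longrightarrow> (f i has_field_derivative f' i z) (at z)"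
    "\<And>i z. i \<in> I \<Longrightarrow> z \<notin> \<int> \<Longrightarrow> (f' i has_field_derivative g i z) (at z)"
    using assms unfolding second_derivative_def by metis
  then show ?thesis
    unfolding second_derivative_def
    by (intro exI[of _ "\<lambda>z. \<Sum>i\<in>I. c i * f' i z"] allI impI conjI DERIV_sum DERIV_cmult) auto
qed

text \<open>The converse change of basis. For \<open>X = cosec_sq\<close> the second derivative of
  \<open>X ^ k\<close> is \<open>N * X ^ Suc k - q * X ^ k\<close>, which can be solved for
  \<open>X ^ Suc k\<close> since \<open>N\<close> is a nonzero rational.\<close>

lemma cosec_sq_power_eq_sum:
  assumes "k \<ge> 1"
  shows "\<exists>c. (\<forall>j. c j \<in> rat_pi_sq) \<and>
      (\<forall>z. z \<notin> \<int> \<longrightarrow> cosec_sq z ^ k = (\<Sum>j=1..k. c j * cosec_series j z))"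
  using assms
proof (induction k rule: nat_induct_at_least)
  case base
  show ?case
    by (rule exI[of _ "\<lambda>_. 1"]) (auto simp: cosec_series_1[symmetric] intro: rat_pi_sq_Rats)
next
  case (Suc k)
  then obtain c where c: "\<And>j. c j \<in> rat_pi_sq"
    "\<And>z. z \<notin> \<int> \<Longrightarrow> cosec_sq z ^ k = (\<Sum>j=1..k. c j * cosec_series j z)"
    by blast
  define N :: complex where "N = of_nat (4 * k * k + 2 * k)"
  define q :: complex where "q = 4 * of_nat k * of_nat k * cpi ^ 2"
  \<comment> \<open>Index \<open>j\<close> collects the second derivative of
    \<open>cosec_series (j - 1)\<close> and \<open>q\<close> times the old term. At
    \<open>j = 1\<close> the factor \<open>j - 1\<close> removes the unspecified
    \<open>c 0\<close>.\<close>
  define c' where "c' j = (of_nat (2 * (j - 1) * (2 * (j - 1) + 1)) * c (j - 1)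
      + (if j \<le> k then q * c j else 0)) / N" for j
  have N: "N \<noteq> 0" "N \<in> \<rat>"
    using Suc.hyps by (auto simp: N_def simp del: of_nat_mult of_nat_add)
  have "q \<in> rat_pi_sq"
    unfolding q_def by (intro rat_pi_sq.mult rat_pi_sq.pi_sq rat_pi_sq_Rats) auto
  then have "c' j \<in> rat_pi_sq" for j
    unfolding c'_def using c(1) N
    by (intro rat_pi_sq_divide_Rats rat_pi_sq.add rat_pi_sq.mult)
        (auto intro: rat_pi_sq.mult rat_pi_sq_Rats simp del: of_nat_mult of_nat_add)
  moreover have "cosec_sq z ^ Suc k = (\<Sum>j=1..Suc k. c' j * cosec_series j z)" if z: "z \<notin> \<int>" for z
  proof -
    have "poly (monom 1 k) (cosec_sq w) = (\<Sum>j=1..k. c j * cosec_series j w)" if "w \<notin> \<int>" for w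
      using c(2)[OF that] by (simp add: poly_monom)
    from second_derivative_unique[OF second_derivative_poly_cosec_sq
        second_derivative_sum[OF second_derivative_cosec_series] this z]
    have "poly (pderiv (pderiv (monom 1 k)) * [:0, 0, - 4 * cpi ^ 2, 4:]
              + pderiv (monom 1 k) * [:0, - 4 * cpi ^ 2, 6:]) (cosec_sq z)
      = (\<Sum>j=1..k. c j * (of_nat (2 * j * (2 * j + 1)) * cosec_series (Suc j) z))"
      by auto
    also have "poly (pderiv (pderiv (monom 1 k)) * [:0, 0, - 4 * cpi ^ 2, 4:]
              + pderiv (monom 1 k) * [:0, - 4 * cpi ^ 2, 6:]) (cosec_sq z)
      = N * cosec_sq z ^ Suc k - q * cosec_sq z ^ k"
    proof -
      \<comment> \<open>The exponent \<open>k - 2\<close> in the second derivative of the monomial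
        sets the case \<open>k = 1\<close> apart.\<close>
      obtain i where k: "k = Suc i" using Suc.hyps by (cases k) auto
      show ?thesis
        by (cases i) (simp_all add: pderiv_monom poly_monom N_def q_def k algebra_simps
            power2_eq_square)
    qed
    finally have "N * cosec_sq z ^ Suc k
        = (\<Sum>j=1..k. c j * (of_nat (2 * j * (2 * j + 1)) * cosec_series (Suc j) z))
        + q * (\<Sum>j=1..k. c j * cosec_series j z)"
      using c(2)[OF z] by (simp add: algebra_simps)
    also have "(\<Sum>j=1..k. c j * (of_nat (2 * j * (2 * j + 1)) * cosec_series (Suc j) z))
      = (\<Sum>j=0..k. c j * (of_nat (2 * j * (2 * j + 1)) * cosec_series (Suc j) z))"
      by (simp add: sum.atLeast_Suc_atMost)
    also have "\<dots> = (\<Sum>j=1..Suc k. of_nat (2 * (j - 1) * (2 * (j - 1) + 1)) * c (j - 1)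
        * cosec_series j z)"
      unfolding One_nat_def sum.shift_bounds_cl_Suc_ivl
        by (intro sum.cong) (auto simp: algebra_simps)
    also have "q * (\<Sum>j=1..k. c j * cosec_series j z)
      = (\<Sum>j=1..Suc k. (if j \<le> k then q * c j else 0) * cosec_series j z)"
      by (simp add: sum_distrib_left mult.assoc)
    also have "(\<Sum>j=1..Suc k. of_nat (2 * (j - 1) * (2 * (j - 1) + 1)) * c (j - 1)
        * cosec_series j z)
        + (\<Sum>j=1..Suc k. (if j \<le> k then q * c j else 0) * cosec_series j z)
      = (\<Sum>j=1..Suc k. (N * c' j) * cosec_series j z)"
      unfolding c'_def sum.distrib[symmetric] using N by (intro sum.cong) (auto simp: distrib_right)
    finally show ?thesis
      using N by (simp only: mult.assoc sum_distrib_left[symmetric]) simp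
  qed
  ultimately show ?case by blast
qed

lemma prod_cosec_series_eq_poly:
  assumes "\<forall>p\<in>set ps. p \<ge> 1"
  shows "\<exists>P. rat_pi_sq_poly P \<and> (ps \<noteq> [] \<longrightarrow> coeff P 0 = 0) \<and>
    (\<forall>z. z \<notin> \<int> \<longrightarrow> (\<Prod>p\<leftarrow>ps. cosec_series p z) = poly P (cosec_sq z))"
  using assms
proof (induction ps)
  case Nil
  show ?case
    by (rule exI[of _ "[:1:]"]) (auto intro!: rat_pi_sq_poly_intros rat_pi_sq_Rats)
next
  case (Cons p ps)
  then obtain P where P: "rat_pi_sq_poly P"
    "\<And>z. z \<notin> \<int> \<Longrightarrow> (\<Prod>p\<leftarrow>ps. cosec_series p z) = poly P (cosec_sq z)"
    by auto
  obtain Q where "rat_pi_sq_poly Q" "coeff Q 0 = 0"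
    "\<And>z. z \<notin> \<int> \<Longrightarrow> cosec_series p z = poly Q (cosec_sq z)"
    using cosec_series_eq_poly[of p] Cons.prems by auto
  with P show ?case
    by (intro exI[of _ "Q * P"]) (auto simp: coeff_mult_0 intro: rat_pi_sq_poly_mult)
qed

lemma prod_cosec_series_eq_sum:
  assumes "ps \<noteq> []" "\<forall>p\<in>set ps. p \<ge> 1"
  shows "\<exists>n d. (\<forall>j. d j \<in> rat_pi_sq) \<and>
    (\<forall>z. z \<notin> \<int> \<longrightarrow> (\<Prod>p\<leftarrow>ps. cosec_series p z) = (\<Sum>j=1..n. d j * cosec_series j z))"
proof -
  obtain P where P: "rat_pi_sq_poly P" "coeff P 0 = 0"
    "\<And>z. z \<notin> \<int> \<Longrightarrow> (\<Prod>p\<leftarrow>ps. cosec_series p z) = poly P (cosec_sq z)"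
    using prod_cosec_series_eq_poly[OF assms(2)] assms(1) by blast
  obtain c where c: "\<And>i j. i \<ge> 1 \<Longrightarrow> c i j \<in> rat_pi_sq"
    "\<And>i z. i \<ge> 1 \<Longrightarrow> z \<notin> \<int> \<Longrightarrow> cosec_sq z ^ i = (\<Sum>j=1..i. c i j * cosec_series j z)"
    using cosec_sq_power_eq_sum by metis
  define n where "n = degree P"
  \<comment> \<open>Padding by 0 makes the triangular double sum rectangular, so its order can be
    exchanged.\<close>
  define d where "d j = (\<Sum>i=1..n. coeff P i * (if j \<le> i then c i j else 0))" for j
  have "d j \<in> rat_pi_sq" for j
    unfolding d_def using P(1) c(1)
    by (intro rat_pi_sq_sum rat_pi_sq.mult) (auto simp: rat_pi_sq_poly_def intro: rat_pi_sq_Rats)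
  moreover have "(\<Prod>p\<leftarrow>ps. cosec_series p z) = (\<Sum>j=1..n. d j * cosec_series j z)" if z: "z \<notin> \<int>" for z
  proof -
    have "(\<Prod>p\<leftarrow>ps. cosec_series p z) = (\<Sum>i\<le>n. coeff P i * cosec_sq z ^ i)"
      using P(3)[OF z] by (simp add: poly_altdef n_def)
    \<comment> \<open>The constant term of \<open>P\<close> is 0, so only positive powers of
      \<open>cosec_sq\<close> have to be expanded.\<close>
    also have "\<dots> = (\<Sum>i=1..n. coeff P i * cosec_sq z ^ i)"
      by (rule sum.mono_neutral_right) (use P(2) in \<open>auto simp: Suc_le_eq\<close>)
    also have "\<dots> = (\<Sum>i=1..n. \<Sum>j=1..n. coeff P i * (if j \<le> i then c i j else 0) * cosec_series j z)"
    proof (rule sum.cong)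
      fix i assume i: "i \<in> {1..n}"
      have "cosec_sq z ^ i = (\<Sum>j=1..i. c i j * cosec_series j z)"
        using c(2)[OF _ z] i by simp
      also have "\<dots> = (\<Sum>j=1..n. (if j \<le> i then c i j else 0) * cosec_series j z)"
        by (rule sum.mono_neutral_cong_left) (use i in auto)
      finally show "coeff P i * cosec_sq z ^ i
          = (\<Sum>j=1..n. coeff P i * (if j \<le> i then c i j else 0) * cosec_series j z)"
        by (simp only: sum_distrib_left mult.assoc)
    qed simp
    also have "\<dots> = (\<Sum>j=1..n. d j * cosec_series j z)"
      by (subst sum.swap) (simp only: d_def sum_distrib_right)
    finally show ?thesis .
  qed
  ultimately show ?thesis by blast
qed

section \<open>Even zeta values, doubled as they occur at \<open>m = 0\<close>\<close>

definition zeta_int :: "nat \<Rightarrow> complex" where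
  "zeta_int p = (\<Sum>\<^sub>\<infinity>n\<in>{n::int. n \<noteq> 0}. 1 / of_int n ^ (2 * p))"

lemma has_sum_zeta_int:
  assumes "p \<ge> 1"
  shows "((\<lambda>n::int. 1 / of_int n ^ (2 * p)) has_sum zeta_int p) {n. n \<noteq> 0}"
proof -
  have s: "(\<lambda>k::nat. 1 / (1 + of_nat k) ^ (2 * p) :: complex) summable_on UNIV"
    using has_sum_inverse_power_nat[of 1 "2 * p - 1"] assms by (auto dest!: has_sum_imp_summable)
  have eq: "((\<lambda>n::int. 1 / of_int n ^ (2 * p) :: complex) \<circ> (\<lambda>k. int k + 1))
      = (\<lambda>k. 1 / (1 + of_nat k) ^ (2 * p))"
    "((\<lambda>n::int. 1 / of_int n ^ (2 * p) :: complex) \<circ> (\<lambda>k. - int k - 1))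
        = (\<lambda>k. 1 / (1 + of_nat k) ^ (2 * p))"
  proof -
    have "(- of_nat k - 1 :: complex) ^ (2 * p) = (1 + of_nat k) ^ (2 * p)" for k
    proof -
      have "(- of_nat k - 1 :: complex) = - (1 + of_nat k)" by simp
      then show ?thesis
        by (simp only: power_minus_even even_mult_iff even_numeral simp_thms)
    qed
    then show "((\<lambda>n::int. 1 / of_int n ^ (2 * p) :: complex) \<circ> (\<lambda>k. - int k - 1))
        = (\<lambda>k. 1 / (1 + of_nat k) ^ (2 * p))"
      by (simp add: o_def)
  qed (simp add: o_def add.commute)
  have "(\<lambda>n::int. 1 / of_int n ^ (2 * p) :: complex) summable_on range (\<lambda>k. int k + 1)"
    by (subst summable_on_reindex) (use s eq in \<open>auto simp: inj_def\<close>)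
  moreover have "(\<lambda>n::int. 1 / of_int n ^ (2 * p) :: complex) summable_on range (\<lambda>k. - int k - 1)"
    by (subst summable_on_reindex) (use s eq in \<open>auto simp: inj_def\<close>)
  ultimately have "(\<lambda>n::int. 1 / of_int n ^ (2 * p) :: complex)
      summable_on (range (\<lambda>k. int k + 1) \<union> range (\<lambda>k. - int k - 1))"
    by (rule summable_on_union)
  moreover have "range (\<lambda>k. int k + 1) \<union> range (\<lambda>k. - int k - 1) = {n. n \<noteq> 0}"
  proof -
    have "n \<in> range (\<lambda>k. int k + 1) \<union> range (\<lambda>k. - int k - 1)" if "n \<noteq> 0" for n
    proof (cases "n > 0")
      case True
      then have "n = int (nat (n - 1)) + 1" by simp
      then show ?thesis by blast
    next
      case False
      then have "n = - int (nat (- n - 1)) - 1" using that by simp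
      then show ?thesis by blast
    qed
    then show ?thesis by auto
  qed
  ultimately show ?thesis
    unfolding zeta_int_def by simp
qed

text \<open>Split the nonzero integers by parity: the even ones give
  \<open>zeta_int p / 2 ^ (2 * p)\<close>, and the odd ones, written \<open>2 * (1 / 2 + n)\<close>,
  give the series at \<open>1 / 2\<close> with the same factor.\<close>

lemma zeta_int_eq:
  assumes "p \<ge> 1"
  shows "(2 ^ (2 * p) - 1) * zeta_int p = cosec_series p (1 / 2)"
proof -
  let ?f = "\<lambda>n::int. 1 / of_int n ^ (2 * p) :: complex"
  have half: "(1 / 2 :: complex) \<notin> \<int>"
    using fraction_not_in_Ints[of 2 1, where 'a = complex] by simp
  have "(?f has_sum (1 / 2 ^ (2 * p)) * zeta_int p) ((\<lambda>n. 2 * n) ` {n. n \<noteq> 0})"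
  proof (subst has_sum_reindex)
    show "(?f \<circ> (\<lambda>n. 2 * n) has_sum (1 / 2 ^ (2 * p)) * zeta_int p) {n. n \<noteq> 0}"
      using has_sum_cmult_right[OF has_sum_zeta_int[OF assms], of "1 / 2 ^ (2 * p)"]
      by (simp add: o_def power_mult_distrib)
  qed (auto simp: inj_on_def)
  moreover have "(?f has_sum (1 / 2 ^ (2 * p)) * cosec_series p (1 / 2)) (range (\<lambda>n. 2 * n + 1))"
  proof (subst has_sum_reindex)
    have "of_int (2 * n + 1) = 2 * (1 / 2 + of_int n :: complex)" for n
      by simp
    then show "(?f \<circ> (\<lambda>n. 2 * n + 1) has_sum (1 / 2 ^ (2 * p)) * cosec_series p (1 / 2)) UNIV"
      using has_sum_cmult_right[OF has_sum_cosec_series[OF half assms], of "1 / 2 ^ (2 * p)"]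
      by (simp only: o_def power_mult_distrib) (simp add: power_mult_distrib)
  qed (auto simp: inj_def)
  ultimately have "(?f has_sum (1 / 2 ^ (2 * p)) * zeta_int p + (1 / 2 ^ (2 * p))
      * cosec_series p (1 / 2))
      ((\<lambda>n. 2 * n) ` {n. n \<noteq> 0} \<union> range (\<lambda>n. 2 * n + 1))"
    by (rule has_sum_Un_disjoint) (auto, presburger)
  also have "(\<lambda>n. 2 * n) ` {n. n \<noteq> 0} \<union> range (\<lambda>n. 2 * n + 1) = {n::int. n \<noteq> 0}"
  proof -
    have "n \<in> (\<lambda>n. 2 * n) ` {n. n \<noteq> 0} \<union> range (\<lambda>n. 2 * n + 1)" if "n \<noteq> 0" for n :: int
      using that by (cases "even n") (auto elim!: evenE oddE)
    then show ?thesis by (auto, presburger)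
  qed
  finally have "zeta_int p = (1 / 2 ^ (2 * p)) * zeta_int p + (1 / 2 ^ (2 * p))
      * cosec_series p (1 / 2)"
    using has_sum_zeta_int[OF assms] has_sum_unique by blast
  then show ?thesis
    by (simp add: field_simps)
qed

lemma zeta_int_in_rat_pi_sq:
  assumes "p \<ge> 1"
  shows "zeta_int p \<in> rat_pi_sq"
proof -
  have half: "(1 / 2 :: complex) \<notin> \<int>"
    using fraction_not_in_Ints[of 2 1, where 'a = complex] by simp
  obtain P where P: "rat_pi_sq_poly P" "cosec_series p (1 / 2) = poly P (cosec_sq (1 / 2))"
    using cosec_series_eq_poly[OF assms] half by blast
  have "cosec_sq (1 / 2) = cpi ^ 2"
    using sin_of_real[of "pi / 2", where 'a = complex] by (simp add: cosec_sq_def)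
  then have "cosec_series p (1 / 2) \<in> rat_pi_sq"
    using P by (auto simp: poly_altdef rat_pi_sq_poly_def
        intro!: rat_pi_sq_sum rat_pi_sq.mult rat_pi_sq_power rat_pi_sq.pi_sq)
  moreover have "(2 ^ (2 * p) - 1 :: complex) \<noteq> 0"
  proof -
    have "(2::real) ^ (2 * p) > 1" using assms by simp
    then have "complex_of_real (2 ^ (2 * p) - 1) \<noteq> 0" by (subst of_real_eq_0_iff) simp
    then show ?thesis by simp
  qed
  then have "zeta_int p = cosec_series p (1 / 2) / (2 ^ (2 * p) - 1)"
    using zeta_int_eq[OF assms] by (simp add: field_simps)
  moreover have "(2 ^ (2 * p) - 1 :: complex) \<in> \<rat>"
    by simp
  ultimately show ?thesis
    by (simp add: rat_pi_sq_divide_Rats)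
qed

section \<open>Eisenstein series\<close>

lemma norm_lattice_point_ge:
  assumes "Im \<tau> > 0"
  obtains C where "C > 0"
    and "\<And>m n :: int. max \<bar>of_int m\<bar> \<bar>of_int n\<bar> \<le> C * norm (of_int m + of_int n * \<tau>)"
proof
  \<comment> \<open>The imaginary part bounds \<open>n\<close> with the constant
    \<open>1 / Im \<tau>\<close>; the triangle inequality then bounds \<open>m\<close> with
    \<open>1 + norm \<tau> / Im \<tau>\<close>.\<close>
  define C where "C = 1 + norm \<tau> / Im \<tau> + 1 / Im \<tau>"
  show "C > 0"
    using assms by (auto simp: C_def intro!: add_pos_nonneg)
  fix m n :: int
  define w where "w = of_int m + of_int n * \<tau>"
  have "\<bar>of_int n\<bar> * Im \<tau> = \<bar>Im w\<bar>"
    using assms by (simp add: w_def abs_mult)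
  also have "\<dots> \<le> norm w"
    by (rule abs_Im_le_cmod)
  finally have n: "\<bar>of_int n\<bar> \<le> norm w / Im \<tau>"
    using assms by (simp add: field_simps)
  have "\<bar>of_int m\<bar> = norm (w - of_int n * \<tau>)"
    by (simp add: w_def)
  also have "\<dots> \<le> norm w + \<bar>of_int n\<bar> * norm \<tau>"
    using norm_triangle_ineq4[of w "of_int n * \<tau>"] by (simp add: norm_mult)
  also have "\<dots> \<le> norm w + norm w / Im \<tau> * norm \<tau>"
    by (intro add_left_mono mult_right_mono n) simp
  finally have m: "\<bar>of_int m\<bar> \<le> norm w + norm w / Im \<tau> * norm \<tau>" .
  have "0 \<le> norm w / Im \<tau> * norm \<tau>" "0 \<le> norm w / Im \<tau>"
    using assms by simp_all
  then show "max \<bar>of_int m\<bar> \<bar>of_int n\<bar> \<le> C * norm (of_int m + of_int n * \<tau>)"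
    using m n unfolding w_def[symmetric] by (simp add: C_def algebra_simps)
qed

text \<open>The exponent \<open>3 / 2\<close> exceeds 1 and is half of 3, so a product of two such
  terms can dominate the inverse cube of a lattice point.\<close>

lemma summable_on_int_powr:
  "(\<lambda>m::int. (1 + \<bar>of_int m\<bar>) powr (- 3 / 2) :: real) summable_on UNIV"
proof -
  have "summable (\<lambda>k. real k powr (- 3 / 2))"
    by (simp add: summable_real_powr_iff)
  then have "summable (\<lambda>k. real (k + 1) powr (- 3 / 2))"
    by (subst summable_iff_shift)
  then have s: "(\<lambda>k::nat. (1 + real k) powr (- 3 / 2)) summable_on UNIV"
    by (subst summable_on_UNIV_nonneg_real_iff) (simp_all add: add.commute)
  have "(\<lambda>k::nat. (1 + real (k + 1)) powr (- 3 / 2)) summable_on UNIV"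
    by (rule summable_on_comparison_test[OF s]) (auto intro!: powr_mono2')
  then show ?thesis
    unfolding UNIV_int_split using s
    by (intro summable_on_union; subst summable_on_reindex)
       (auto simp: inj_def o_def algebra_simps cong: summable_on_cong)
qed

text \<open>If \<open>w\<close> is the norm of the lattice point,
  \<open>(1 + \<bar>m\<bar>) * (1 + \<bar>n\<bar>)\<close> is at most
  \<open>(2 * C * w) ^ 2\<close>. Raised to the power \<open>3 / 2\<close>, this bounds
  \<open>1 / w ^ 3\<close> by a product of two summable functions of one variable.\<close>

lemma summable_on_lattice_cube:
  assumes "Im \<tau> > 0"
  shows "(\<lambda>(m, n). 1 / norm (of_int m + of_int n * \<tau>) ^ 3) summable_on - {(0 :: int, 0 :: int)}"
proof -
  obtain C where C: "C > 0"
    "\<And>m n :: int. max \<bar>of_int m\<bar> \<bar>of_int n\<bar> \<le> C * norm (of_int m + of_int n * \<tau>)"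
    using norm_lattice_point_ge[OF assms] by blast
  let ?h = "\<lambda>m::int. (1 + \<bar>of_int m\<bar>) powr (- 3 / 2) :: real"
  have "(\<lambda>x. norm (?h (fst x) * ?h (snd x))) summable_on (UNIV \<times> UNIV)"
  proof (subst Infinite_Sum.abs_summable_on_Sigma_iff, intro conjI ballI)
    show "(\<lambda>n. norm (?h (fst (m, n)) * ?h (snd (m, n)))) summable_on UNIV" for m
      using summable_on_cmult_right[OF summable_on_int_powr, of "?h m"] by simp
    have "norm (\<Sum>\<^sub>\<infinity>n. norm (?h (fst (m, n)) * ?h (snd (m, n)))) = ?h m * infsum ?h UNIV" for m
    proof -
      have "(\<Sum>\<^sub>\<infinity>n. norm (?h (fst (m, n)) * ?h (snd (m, n)))) = (\<Sum>\<^sub>\<infinity>n. ?h m * ?h n)"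
        by (intro infsum_cong) (simp add: abs_mult)
      moreover have "0 \<le> infsum ?h UNIV"
        by (intro infsum_nonneg) auto
      ultimately show ?thesis
        by (simp add: infsum_cmult_right' abs_mult)
    qed
    then show "(\<lambda>m. norm (\<Sum>\<^sub>\<infinity>n. norm (?h (fst (m, n)) * ?h (snd (m, n))))) summable_on UNIV"
      using summable_on_cmult_left[OF summable_on_int_powr, of "infsum ?h UNIV"] by (simp only:)
  qed
  then have "(\<lambda>x. ?h (fst x) * ?h (snd x)) summable_on - {(0, 0)}"
    by (rule summable_on_subset[OF abs_summable_summable]) auto
  then have "(\<lambda>x. (2 * C) ^ 3 * (?h (fst x) * ?h (snd x))) summable_on - {(0, 0)}"
    by (rule summable_on_cmult_right)
  then show ?thesis
  proof (rule summable_on_comparison_test)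
    fix x :: "int \<times> int" assume "x \<in> - {(0, 0)}"
    then obtain m n where x: "x = (m, n)" "m \<noteq> 0 \<or> n \<noteq> 0" by (cases x) auto
    define M :: real where "M = max \<bar>of_int m\<bar> \<bar>of_int n\<bar>"
    define w where "w = norm (of_int m + of_int n * \<tau>)"
    have "M \<ge> 1" using x by (auto simp: M_def)
    have M: "M \<le> C * w" using C(2) by (simp add: M_def w_def)
    with \<open>M \<ge> 1\<close> have "C * w > 0" by linarith
    then have w: "w > 0"
      using C(1) by (simp add: zero_less_mult_iff)
    have "(1 + \<bar>of_int m\<bar>) * (1 + \<bar>of_int n\<bar>) \<le> (2 * M) * (2 * M)"
      using \<open>M \<ge> 1\<close> by (intro mult_mono) (auto simp: M_def)
    also have "\<dots> \<le> (2 * (C * w)) * (2 * (C * w))"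
      using M \<open>M \<ge> 1\<close> by (intro mult_mono) auto
    finally have *: "(1 + \<bar>of_int m\<bar>) * (1 + \<bar>of_int n\<bar>) \<le> (2 * C * w) ^ 2"
      by (simp add: power2_eq_square mult_ac)
    have "((2 * C * w) ^ 2) powr (3 / 2) = ((2 * C * w) powr 2) powr (3 / 2)"
      using w C(1) by simp
    also have "\<dots> = (2 * C * w) powr 3"
      by (subst powr_powr) simp
    also have "\<dots> = (2 * C * w) ^ 3"
      using w C(1) by simp
    finally have "((1 + \<bar>of_int m\<bar>) * (1 + \<bar>of_int n\<bar>)) powr (3 / 2) \<le> (2 * C * w) ^ 3"
      using powr_mono2[OF _ _ *, of "3 / 2"] by simp
    then have le: "(1 + \<bar>of_int m\<bar>) powr (3 / 2) * (1 + \<bar>of_int n\<bar>) powr (3 / 2) \<le> (2 * C * w) ^ 3"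
      by (simp add: powr_mult)
    have h: "?h m = 1 / (1 + \<bar>of_int m\<bar>) powr (3 / 2)" for m
      using powr_minus_divide[of "1 + \<bar>of_int m\<bar>" "3 / 2"] by simp
    have pos: "(1 + \<bar>of_int m\<bar>) powr (3 / 2) > (0 :: real)" for m :: int
      by simp
    have "1 / w ^ 3 \<le> (2 * C) ^ 3 * (?h m * ?h n)"
      using le pos[of m] pos[of n] w unfolding h
      by (simp add: divide_simps power_mult_distrib mult_ac)
    then show "(case x of (m, n) \<Rightarrow> 1 / norm (of_int m + of_int n * \<tau>) ^ 3)
        \<le> (2 * C) ^ 3 * (?h (fst x) * ?h (snd x))"
      by (simp only: x w_def prod.case fst_conv snd_conv)
  qed auto
qed

definition tau_lattice :: "complex \<Rightarrow> complex set" where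
  "tau_lattice \<tau> = (\<lambda>(m, n). of_int m + of_int n * \<tau>) ` (UNIV :: (int \<times> int) set)"

lemma lattice_point_inj:
  assumes "Im \<tau> > 0"
  shows "of_int m + of_int n * \<tau> = of_int m' + of_int n' * \<tau> \<longleftrightarrow> m = m' \<and> n = n'"
  using assms by (auto simp: complex_eq_iff)

lemma bij_betw_lattice:
  assumes "Im \<tau> > 0"
  shows "bij_betw (\<lambda>(m, n). of_int m + of_int n * \<tau>) (- {(0 :: int, 0 :: int)})
      (tau_lattice \<tau> - {0})"
proof -
  have inj: "inj (\<lambda>(m::int, n::int). of_int m + of_int n * \<tau>)"
    by (auto simp: inj_def lattice_point_inj[OF assms])
  have "(\<lambda>(m, n). of_int m + of_int n * \<tau>) ` (- {(0 :: int, 0 :: int)}) = tau_lattice \<tau> - {0}"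
    unfolding Compl_eq_Diff_UNIV image_set_diff[OF inj] by (simp add: tau_lattice_def)
  with inj show ?thesis
    by (auto simp: bij_betw_def intro: inj_on_subset)
qed

lemma plane_lattice_tau:
  assumes "Im \<tau> > 0"
  shows "plane_lattice (tau_lattice \<tau>)"
proof
  show "0 \<in> tau_lattice \<tau>"
    unfolding tau_lattice_def by (rule image_eqI[of _ _ "(0, 0)"]) auto
  fix u v assume "u \<in> tau_lattice \<tau>" "v \<in> tau_lattice \<tau>"
  then obtain m n m' n' where "u = of_int m + of_int n * \<tau>" "v = of_int m' + of_int n' * \<tau>"
    by (auto simp: tau_lattice_def)
  then show "u - v \<in> tau_lattice \<tau>"
    unfolding tau_lattice_def by (intro image_eqI[of _ _ "(m - m', n - n')"])
        (auto simp: algebra_simps)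
next
  show "(\<lambda>u. 1 / norm u ^ 3) summable_on tau_lattice \<tau> - {0}"
    using summable_on_lattice_cube[OF assms]
      summable_on_reindex_bij_betw[OF bij_betw_lattice[OF assms], of "\<lambda>u. 1 / norm u ^ 3"]
    by (simp add: case_prod_unfold)
qed

section \<open>Inner sums and convergence of the outer sum\<close>

definition eisenstein_inner :: "nat \<Rightarrow> complex \<Rightarrow> int \<Rightarrow> complex" where
  "eisenstein_inner k \<tau> m = (\<Sum>\<^sub>\<infinity>n\<in>{n::int. (m, n) \<noteq> (0, 0)}. 1 / (of_int m + of_int n * \<tau>) ^ k)"

text \<open>From exponent 3 on, absolute convergence over pairs identifies the iterated sum with the
  sum over lattice points.\<close>

lemma
  assumes "Im \<tau> > 0" "k \<ge> 3"
  shows eisenstein_G_eq_lattice_G: "eisenstein_G k \<tau> = plane_lattice.G (tau_lattice \<tau>) k"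
    and summable_eisenstein_inner_ge3: "eisenstein_inner k \<tau> summable_on UNIV"
proof -
  interpret plane_lattice "tau_lattice \<tau>" by (rule plane_lattice_tau[OF assms(1)])
  have Sig: "Sigma UNIV (\<lambda>m. {n::int. (m, n) \<noteq> (0, 0)}) = - {(0 :: int, 0 :: int)}"
    by auto
  have "((\<lambda>(m, n). 1 / (of_int m + of_int n * \<tau>) ^ k) has_sum G k) (- {(0 :: int, 0 :: int)})"
    using has_sum_G[OF assms(2)]
        has_sum_reindex_bij_betw[OF bij_betw_lattice[OF assms(1)], of "\<lambda>u. 1 / u ^ k"]
    by (simp add: case_prod_unfold)
  then have *: "((\<lambda>(m, n). 1 / (of_int m + of_int n * \<tau>) ^ k) has_sum G k)
      (Sigma UNIV (\<lambda>m. {n::int. (m, n) \<noteq> (0, 0)}))"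
    by (simp only: Sig)
  from infsum_Sigma'_banach[OF has_sum_imp_summable[OF this]] infsumI[OF *]
  show "eisenstein_G k \<tau> = G k"
    by (simp add: eisenstein_G_def)
  from summable_on_Sigma_banach[OF has_sum_imp_summable[OF *]]
  show "eisenstein_inner k \<tau> summable_on UNIV"
    by (simp add: eisenstein_inner_def[abs_def])
qed

lemma div_tau_not_Int:
  assumes "Im \<tau> > 0" "m \<noteq> 0"
  shows "of_int m / \<tau> \<notin> \<int>"
proof
  assume "of_int m / \<tau> \<in> \<int>"
  then obtain j where "of_int m / \<tau> = of_int j" by (elim Ints_cases)
  moreover have "\<tau> \<noteq> 0" using assms by auto
  ultimately have "of_int m + of_int (- j) * \<tau> = of_int 0 + of_int 0 * \<tau>"
    by (simp add: field_simps)
  then show False using assms lattice_point_inj by blast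
qed

lemma eisenstein_inner_nonzero:
  assumes "Im \<tau> > 0" "m \<noteq> 0"
  shows "\<tau> ^ (2 * p) * eisenstein_inner (2 * p) \<tau> m = cosec_series p (of_int m / \<tau>)"
proof -
  have "\<tau> \<noteq> 0" using assms by auto
  then have *: "of_int m / \<tau> + of_int n = (of_int m + of_int n * \<tau>) / \<tau>" for n
    by (simp add: field_simps)
  show ?thesis
    unfolding eisenstein_inner_def cosec_series_def infsum_cmult_right'[symmetric] *
    using assms(2) by (simp add: power_divide)
qed

lemma eisenstein_inner_zero:
  assumes "Im \<tau> > 0"
  shows "\<tau> ^ (2 * p) * eisenstein_inner (2 * p) \<tau> 0 = zeta_int p"
proof -
  have "\<tau> \<noteq> 0" using assms by auto
  moreover have "{n::int. (0 :: int, n) \<noteq> (0, 0)} = {n. n \<noteq> 0}" by simp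
  ultimately show ?thesis
    unfolding eisenstein_inner_def zeta_int_def infsum_cmult_right'[symmetric]
    by (simp add: power_mult_distrib)
qed

text \<open>A linear bound suffices for weight 2: since \<open>Im (m / \<tau>)\<close> is
  proportional to \<open>m\<close>, it makes \<open>cosec_sq (m / \<tau>)\<close> of order
  \<open>1 / m ^ 2\<close>.\<close>

lemma norm_sin_ge: "norm (sin z) \<ge> \<bar>Im z\<bar> / 2"
proof -
  define y where "y = \<bar>Im z\<bar>"
  have "\<bar>exp (- Im z) - exp (Im z)\<bar> \<ge> y"
  proof -
    have "exp y \<ge> 1 + y" "exp (- y) \<le> 1"
      by (auto simp: y_def exp_ge_add_one_self)
    then have "exp y - exp (- y) \<ge> y" by linarith
    then show ?thesis by (auto simp: y_def abs_if split: if_splits)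
  qed
  also have "\<bar>exp (- Im z) - exp (Im z)\<bar> \<le> norm (exp (\<i> * z) - exp (- (\<i> * z)))"
    using norm_triangle_ineq3[of "exp (\<i> * z)" "exp (- (\<i> * z))"] by simp
  also have "norm (exp (\<i> * z) - exp (- (\<i> * z))) = 2 * norm (sin z)"
    by (simp add: sin_exp_eq norm_divide norm_mult)
  finally show ?thesis by (simp add: y_def)
qed

lemma summable_eisenstein_inner:
  assumes "Im \<tau> > 0" "p \<ge> 1"
  shows "eisenstein_inner (2 * p) \<tau> summable_on UNIV"
proof (cases "p = 1")
  case False
  then show ?thesis
    using assms by (intro summable_eisenstein_inner_ge3) auto
next
  case True
  have "\<tau> \<noteq> 0" using assms by auto
  \<comment> \<open>Chosen so that \<open>4 / \<bar>Im (m / \<tau>)\<bar> ^ 2 = norm \<tau> ^ 2 * K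
    / m ^ 2\<close>.\<close>
  define K where "K = 4 * norm \<tau> ^ 2 / Im \<tau> ^ 2"
  have bound: "norm (eisenstein_inner 2 \<tau> m) \<le> K * norm (1 / complex_of_int m ^ 2)" if m: "m \<noteq> 0"
      for m
  proof -
    define z where "z = of_int m / \<tau>"
    have z: "z \<notin> \<int>" unfolding z_def using assms m by (intro div_tau_not_Int)
    have Imz: "\<bar>Im z\<bar> = \<bar>of_int m\<bar> * Im \<tau> / norm \<tau> ^ 2"
      using assms by (simp add: z_def Im_divide cmod_power2 abs_mult abs_divide)
    then have Im_pos: "\<bar>Im z\<bar> > 0" using assms m \<open>\<tau> \<noteq> 0\<close> by simp
    have "\<tau> ^ 2 * eisenstein_inner 2 \<tau> m = cosec_sq z"
      using eisenstein_inner_nonzero[OF assms(1) m, of 1] cosec_series_1[OF z] by (simp add: z_def)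
    then have "norm \<tau> ^ 2 * norm (eisenstein_inner 2 \<tau> m) = (pi / norm (sin (cpi * z))) ^ 2"
      unfolding cosec_sq_def by (metis norm_mult norm_power norm_divide norm_of_real abs_of_pos
          pi_gt_zero)
    also have "\<dots> \<le> (pi / (pi * \<bar>Im z\<bar> / 2)) ^ 2"
    proof (intro power_mono divide_left_mono mult_pos_pos)
      show lb: "pi * \<bar>Im z\<bar> / 2 \<le> norm (sin (cpi * z))"
        using norm_sin_ge[of "cpi * z"] by (simp add: abs_mult)
      show "0 < pi * \<bar>Im z\<bar> / 2"
        using Im_pos by simp
      with lb show "0 < norm (sin (cpi * z))"
        by linarith
    qed simp_all
    also have "\<dots> = 4 / \<bar>Im z\<bar> ^ 2"
      by (simp add: power_divide)
    also have "\<dots> = norm \<tau> ^ 2 * (K * norm (1 / complex_of_int m ^ 2))"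
      unfolding Imz K_def using assms m \<open>\<tau> \<noteq> 0\<close>
      by (simp add: norm_divide norm_mult field_simps eval_nat_numeral)
    finally show ?thesis
      using \<open>\<tau> \<noteq> 0\<close> by simp
  qed
  have "(\<lambda>m::int. norm (1 / complex_of_int m ^ 2)) summable_on {m. m \<noteq> 0}"
    using has_sum_imp_summable[OF has_sum_zeta_int[of 1]]
    by (simp add: summable_on_iff_abs_summable_on_complex)
  then have "(\<lambda>m. K * norm (1 / complex_of_int m ^ 2)) summable_on {m. m \<noteq> 0}"
    by (rule summable_on_cmult_right)
  then have "(\<lambda>m. norm (eisenstein_inner 2 \<tau> m)) summable_on {m. m \<noteq> 0}"
    by (rule Infinite_Sum.abs_summable_on_comparison_test') (use bound in auto)
  then have "eisenstein_inner 2 \<tau> summable_on {m. m \<noteq> 0}"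
    by (rule abs_summable_summable)
  then have "eisenstein_inner 2 \<tau> summable_on (insert 0 {m. m \<noteq> 0})"
    by (simp add: summable_on_insert_iff)
  moreover have "insert 0 {m. m \<noteq> 0} = (UNIV :: int set)" by auto
  ultimately show ?thesis using True by simp
qed

lemma has_sum_eisenstein_inner:
  assumes "Im \<tau> > 0" "p \<ge> 1"
  shows "(eisenstein_inner (2 * p) \<tau> has_sum eisenstein_G (2 * p) \<tau>) UNIV"
  using has_sum_infsum[OF summable_eisenstein_inner[OF assms]]
  by (simp add: eisenstein_G_def eisenstein_inner_def[abs_def])

text \<open>No convergence is assumed: over a field, constant factors can be pulled out of
  \<open>infsum\<close> even when the sum diverges.\<close>

lemma iterated_infsum_prod:
  "iterated_infsum A r (\<lambda>ns. \<Prod>j<r. g j (ns ! j)) = (\<Prod>j<r. infsum (g j) A)"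
proof (induction r arbitrary: g)
  case (Suc r)
  \<comment> \<open>For the inner sums the outermost factor is a constant \<open>c\<close>. Merging
    it into the first inner factor, as \<open>h\<close> does, leaves a pure product to which the
    induction hypothesis applies.\<close>
  have inner: "iterated_infsum A r (\<lambda>ns. c * (\<Prod>j<r. g (Suc j) (ns ! j)))
      = c * (\<Prod>j<r. infsum (g (Suc j)) A)" for c
  proof (cases r)
    case (Suc r')
    then obtain r' where r: "r = Suc r'" by simp
    define h where "h j = (if j = 0 then (\<lambda>n. c * g 1 n) else g (Suc j))" for j
    have "iterated_infsum A r (\<lambda>ns. c * (\<Prod>j<r. g (Suc j) (ns ! j)))
        = iterated_infsum A r (\<lambda>ns. \<Prod>j<r. h j (ns ! j))"
      unfolding r prod.lessThan_Suc_shift by (simp add: h_def mult.assoc)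
    also have "\<dots> = (\<Prod>j<r. infsum (h j) A)"
      by (rule Suc.IH)
    also have "\<dots> = c * (\<Prod>j<r. infsum (g (Suc j)) A)"
      unfolding r prod.lessThan_Suc_shift by (simp add: h_def infsum_cmult_right')
    finally show ?thesis .
  qed simp
  show ?case
    by (simp add: prod.lessThan_Suc_shift inner infsum_cmult_left' del: prod.lessThan_Suc)
qed simp

lemma G_tilde_eq:
  "G_tilde ps \<tau> = (\<Sum>\<^sub>\<infinity>m. \<Prod>p\<leftarrow>ps. eisenstein_inner (2 * p) \<tau> m)"
proof -
  have "(\<Prod>j<length ps. f (ps ! j)) = (\<Prod>p\<leftarrow>ps. f p)" for f :: "nat \<Rightarrow> complex"
    by (induction ps) (simp_all add: prod.lessThan_Suc_shift del: prod.lessThan_Suc)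
  from this[symmetric] show ?thesis
    unfolding G_tilde_def iterated_infsum_prod[of _ _ "\<lambda>j n. 1
        / (of_int m + of_int n * \<tau>) ^ (2 * ps ! j)" for m]
    by (simp only: eisenstein_inner_def)
qed

text \<open>\<open>n\<close> and \<open>d\<close> are fixed before \<tau>, as a polynomial
  expression in functions of \<tau> requires.\<close>

lemma G_tilde_expansion:
  assumes "ps \<noteq> []" "\<forall>p\<in>set ps. p \<ge> 1"
  obtains n d where "\<And>j. d j \<in> rat_pi_sq"
    and "\<And>\<tau>. Im \<tau> > 0 \<Longrightarrow> \<tau> ^ (2 * sum_list ps) * G_tilde ps \<tau> =
      (\<Sum>j=1..n. d j * (\<tau> ^ (2 * j) * eisenstein_G (2 * j) \<tau>))
      + ((\<Prod>p\<leftarrow>ps. zeta_int p) - (\<Sum>j=1..n. d j * zeta_int j))"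
proof -
  obtain n d where d: "\<And>j. d j \<in> rat_pi_sq"
    and prod: "\<And>z. z \<notin> \<int> \<Longrightarrow> (\<Prod>p\<leftarrow>ps. cosec_series p z) = (\<Sum>j=1..n. d j * cosec_series j z)"
    using prod_cosec_series_eq_sum[OF assms] by blast
  show ?thesis
  proof (rule that[OF d])
    fix \<tau> :: complex assume tau: "Im \<tau> > 0"
    \<comment> \<open>The product identity holds off the integers and so says nothing at
      \<open>m = 0\<close>; \<open>c\<close> is the discrepancy between its two sides there.\<close>
    define c where "c = (\<Prod>p\<leftarrow>ps. zeta_int p) - (\<Sum>j=1..n. d j * zeta_int j)"
    have power: "\<tau> ^ (2 * sum_list ps) * (\<Prod>p\<leftarrow>ps. f p) = (\<Prod>p\<leftarrow>ps. \<tau> ^ (2 * p) * f p)"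
        for f :: "nat \<Rightarrow> complex"
      by (induction ps) (simp_all add: power_add mult_ac)
    have eq: "(\<Prod>p\<leftarrow>ps. \<tau> ^ (2 * p) * eisenstein_inner (2 * p) \<tau> m) =
      (\<Sum>j=1..n. d j * (\<tau> ^ (2 * j) * eisenstein_inner (2 * j) \<tau> m)) + (if m = 0 then c else 0)"
          for m
    proof (cases "m = 0")
      case True
      then show ?thesis
        by (simp add: eisenstein_inner_zero[OF tau] c_def)
    next
      case False
      then show ?thesis
        by (simp add: eisenstein_inner_nonzero[OF tau] prod[OF div_tau_not_Int[OF tau]])
    qed
    have "((\<lambda>m::int. if m = 0 then c else 0) has_sum c) UNIV"
      by (rule has_sum_finite_neutralI[of "{0}"]) auto
    then have "((\<lambda>m. (\<Sum>j=1..n. d j * (\<tau> ^ (2 * j) * eisenstein_inner (2 * j) \<tau> m))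
        + (if m = 0 then c else 0))
      has_sum ((\<Sum>j=1..n. d j * (\<tau> ^ (2 * j) * eisenstein_G (2 * j) \<tau>)) + c)) UNIV"
      by (intro has_sum_add has_sum_finite_sum has_sum_cmult_right has_sum_eisenstein_inner tau)
          auto
    then show "\<tau> ^ (2 * sum_list ps) * G_tilde ps \<tau> =
      (\<Sum>j=1..n. d j * (\<tau> ^ (2 * j) * eisenstein_G (2 * j) \<tau>))
      + ((\<Prod>p\<leftarrow>ps. zeta_int p) - (\<Sum>j=1..n. d j * zeta_int j))"
      unfolding G_tilde_eq infsum_cmult_right'[symmetric] power eq c_def[symmetric]
        by (rule infsumI)
  qed
qed

text \<open>Strong induction with \<open>G_recursion\<close>. Odd \<open>k\<close> are included
  because the convolution sum there runs over odd indices too.\<close>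

lemma eisenstein_G_in_rat_polynomials:
  assumes gens: "eisenstein_G 4 \<in> rat_polynomials_on {\<tau>. Im \<tau> > 0} gs"
    "eisenstein_G 6 \<in> rat_polynomials_on {\<tau>. Im \<tau> > 0} gs"
    and "k \<ge> 3"
  shows "eisenstein_G k \<in> rat_polynomials_on {\<tau>. Im \<tau> > 0} gs"
  using assms(3)
proof (induction k rule: less_induct)
  case (less k)
  have "odd k \<or> k = 4 \<or> k = 6 \<or> even k \<and> k \<ge> 8"
    using less.prems by presburger
  then consider "odd k" | "k = 4" | "k = 6" | "even k" "k \<ge> 8"
    by blast
  then show ?case
  proof cases
    case 1
    have "(\<lambda>_. of_rat 0) \<in> rat_polynomials_on {\<tau>. Im \<tau> > 0} gs"
      by (rule rat_polynomials_on_const)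
    then show ?thesis
      by (rule rat_polynomials_on_cong)
         (use 1 less.prems in \<open>auto simp: eisenstein_G_eq_lattice_G plane_lattice.G_odd
             plane_lattice_tau\<close>)
  next
    case 4
    define M where "M = k - 2"
    have M: "M \<ge> 6" "even M" "k = M + 2" using 4 by (auto simp: M_def)
    define D where "D = int M + 1 - (\<Sum>i=2..M - 2. rec_coeff M i)"
    have "D \<noteq> 0" using sum_rec_coeff_nonpos[OF M(1)] by (simp add: D_def)
    have "(\<lambda>\<tau>. of_rat (1 / of_int D) * (of_rat 3 * eisenstein_G 4 \<tau> * eisenstein_G (M - 2) \<tau>
        - (\<Sum>i=2..M - 2. of_rat (of_int (rec_coeff M i))
            * (eisenstein_G (Suc i) \<tau> * eisenstein_G (M + 1 - i) \<tau>))))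
        \<in> rat_polynomials_on {\<tau>. Im \<tau> > 0} gs"
      \<comment> \<open>The indices \<open>Suc i\<close>, \<open>M + 1 - i\<close> and
        \<open>M - 2\<close> lie between 3 and \<open>M - 1\<close>, hence below
        \<open>k\<close>.\<close>
      using M
      by (intro rat_polynomials_on_mult rat_polynomials_on_diff rat_polynomials_on_sum
          rat_polynomials_on_const gens less.IH) auto
    then show ?thesis
    proof (rule rat_polynomials_on_cong)
      fix \<tau> assume "\<tau> \<in> {\<tau>. Im \<tau> > 0}"
      then have tau: "Im \<tau> > 0" by simp
      interpret plane_lattice "tau_lattice \<tau>" by (rule plane_lattice_tau[OF tau])
      have "(\<Sum>i=2..M - 2. of_int (rec_coeff M i)
          * (eisenstein_G (Suc i) \<tau> * eisenstein_G (M + 1 - i) \<tau>))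
        = (\<Sum>i=2..M - 2. of_int (rec_coeff M i) * (G (Suc i) * G (M + 1 - i)))"
      proof (intro sum.cong refl)
        fix i assume "i \<in> {2..M - 2}"
        then have "Suc i \<ge> 3" "M + 1 - i \<ge> 3" using M(1) by auto
        then show "of_int (rec_coeff M i) * (eisenstein_G (Suc i) \<tau> * eisenstein_G (M + 1 - i) \<tau>)
            = of_int (rec_coeff M i) * (G (Suc i) * G (M + 1 - i))"
          by (simp only: eisenstein_G_eq_lattice_G[OF tau])
      qed
      then have "of_int D * eisenstein_G k \<tau> = 3 * eisenstein_G 4 \<tau> * eisenstein_G (M - 2) \<tau>
        - (\<Sum>i=2..M - 2. of_int (rec_coeff M i)
            * (eisenstein_G (Suc i) \<tau> * eisenstein_G (M + 1 - i) \<tau>))"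
        using G_recursion[OF M(1,2)] M
          by (simp add: D_def eisenstein_G_eq_lattice_G[OF tau] del: of_int_diff of_int_add)
      then show "of_rat (1 / of_int D) * (of_rat 3 * eisenstein_G 4 \<tau> * eisenstein_G (M - 2) \<tau>
        - (\<Sum>i=2..M - 2. of_rat (of_int (rec_coeff M i))
            * (eisenstein_G (Suc i) \<tau> * eisenstein_G (M + 1 - i) \<tau>)))
        = eisenstein_G k \<tau>"
        using \<open>D \<noteq> 0\<close> by (simp add: of_rat_divide field_simps)
    qed
  qed (use gens in simp_all)
qed

theorem theorem1p2:
  fixes r :: nat and ps :: "nat list"
  assumes "r \<ge> 2" and "length ps = r" and "\<forall>p\<in>set ps. p \<ge> 1"
  shows "(\<lambda>\<tau>. \<tau> ^ (2 * sum_list ps) * G_tilde ps \<tau>)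
           \<in> rat_polynomials_on {\<tau>. Im \<tau> > 0}
               [\<lambda>\<tau>. \<tau>\<^sup>2, \<lambda>\<tau>. (complex_of_real pi)\<^sup>2,
                eisenstein_G 2, eisenstein_G 4, eisenstein_G 6]"
proof -
  let ?R = "rat_polynomials_on {\<tau>. Im \<tau> > 0}
    [\<lambda>\<tau>. \<tau>\<^sup>2, \<lambda>\<tau>. (complex_of_real pi)\<^sup>2, eisenstein_G 2, eisenstein_G 4, eisenstein_G 6]"
  have gen: "g \<in> ?R"
    if "g \<in> {\<lambda>\<tau>. \<tau>\<^sup>2, \<lambda>\<tau>. (complex_of_real pi)\<^sup>2, eisenstein_G 2, eisenstein_G 4, eisenstein_G 6}"
        for g
    by (rule rat_polynomials_on_generator) (use that in simp)
  \<comment> \<open>Rule induction on \<open>rat_pi_sq\<close>, whose only irrational generator is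
    the second of the listed functions.\<close>
  have const: "(\<lambda>_. c) \<in> ?R" if "c \<in> rat_pi_sq" for c
    using that
  proof induction
    case pi_sq
    show ?case by (rule gen) simp
  next
    case (add a b)
    then show ?case by (intro rat_polynomials_on_add)
  next
    case (mult a b)
    then show ?case by (intro rat_polynomials_on_mult)
  qed (rule rat_polynomials_on_const)
  have G: "eisenstein_G (2 * j) \<in> ?R" if "j \<ge> 1" for j
  proof (cases "j = 1")
    case True
    then show ?thesis by (simp add: gen)
  next
    case False
    have "eisenstein_G 4 \<in> ?R" "eisenstein_G 6 \<in> ?R" by (rule gen, simp)+
    then show ?thesis
      by (rule eisenstein_G_in_rat_polynomials) (use that False in simp)
  qed
  obtain n d where d: "\<And>j. d j \<in> rat_pi_sq"
    and expansion: "\<And>\<tau>. Im \<tau> > 0 \<Longrightarrow> \<tau> ^ (2 * sum_list ps) * G_tilde ps \<tau> =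
      (\<Sum>j=1..n. d j * (\<tau> ^ (2 * j) * eisenstein_G (2 * j) \<tau>))
      + ((\<Prod>p\<leftarrow>ps. zeta_int p) - (\<Sum>j=1..n. d j * zeta_int j))"
    by (rule G_tilde_expansion[OF _ assms(3)]) (use assms in auto)
  \<comment> \<open>Only even powers of \<tau> occur in the expansion; they are powers of the first
    generator.\<close>
  have "(\<lambda>\<tau>. \<tau>\<^sup>2) \<in> ?R"
    by (rule gen) simp
  then have "(\<lambda>\<tau>. (\<tau>\<^sup>2) ^ j) \<in> ?R" for j
    by (rule rat_polynomials_on_power)
  then have "(\<lambda>\<tau>. d j * ((\<tau>\<^sup>2) ^ j * eisenstein_G (2 * j) \<tau>)) \<in> ?R" if "j \<in> {1..n}" for j
    using that by (intro rat_polynomials_on_mult const d G) auto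
  then have sum: "(\<lambda>\<tau>. \<Sum>j=1..n. d j * ((\<tau>\<^sup>2) ^ j * eisenstein_G (2 * j) \<tau>)) \<in> ?R"
    by (rule rat_polynomials_on_sum)
  have "(\<Prod>p\<leftarrow>ps. zeta_int p) - (\<Sum>j=1..n. d j * zeta_int j) \<in> rat_pi_sq"
    using assms by (intro rat_pi_sq_diff rat_pi_sq_sum rat_pi_sq.mult d rat_pi_sq_prod_list
        zeta_int_in_rat_pi_sq) auto
  from rat_polynomials_on_add[OF sum const[OF this]] show ?thesis
    by (rule rat_polynomials_on_cong) (subst expansion, simp_all add: power_mult)
qed

end
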